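(* Let $(a_n)$ and $(z_n)$ be sequences in $\mathbb{D}$, each satisfying the Blaschke condition and each $\rho$-separated, and suppose $\sup_n\rho(a_n,z_n)\le\lambda<1$ for some $\lambda$. Let $B$ and $C$ be the Blaschke products with zero sequences $(a_n)$ and $(z_n)$, respectively. Then $(a_n)$ is interpolating for $K_B^\infty$ if and only if $(z_n)$ is interpolating for $K_C^\infty$.
   Context: $\mathbb{D}$ is the open unit disk and $\mathbb{T}$ the unit circle. $H^\infty$ is the space of bounded analytic functions on $\mathbb{D}$, identified with their boundary functions on $\mathbb{T}$. For an inner function $\theta$, $K_\theta^\infty := H^\infty\cap \theta\,\overline{zH^\infty}$ (as functions on $\mathbb{T}$), where $\overline{zH^\infty}$ is the set of functions whose complex conjugate lies in $zH^\infty$; elements are evaluated at points of $\mathbb{D}$ via their analytic extension. A sequence $(w_n)$ in $\mathbb{D}$ is interpolating for $K_\theta^\infty$ if for every bounded sequence $(\alpha_n)$ of complex numbers there is $f\in K_\theta^\infty$ with $f(w_n)=\alpha_n$ for all $n$. The pseudohyperbolic distance is $\rho(a,z)=\left|\frac{z-a}{1-\overline{a}z}\right|$ for $a,z\in\mathbb{D}$. A sequence $(z_n)$ in $\mathbb{D}$ is $\rho$-separated if $\inf_{j\ne k}\rho(z_j,z_k)>0$. A sequence $(a_j)$ in $\mathbb{D}$ satisfies the Blaschke condition if $\sum_j(1-|a_j|)<\infty$; the corresponding Blaschke product is $B(z)=\lambda\prod_j \frac{|a_j|}{-a_j}\frac{z-a_j}{1-\overline{a_j}z}$ with $\lambda\in\mathbb{T}$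 (with $|a_j|/a_j$ read as $1$ if $a_j=0$). *)

theory Defs
  imports "HOL-Analysis.Analysis"
begin

abbreviation unit_disc :: "complex set" where
  "unit_disc \<equiv> ball 0 1"

definition H_inf :: "(complex \<Rightarrow> complex) set" where
  "H_inf = {f. f holomorphic_on unit_disc \<and> bounded (f ` unit_disc)}"

definition has_boundary_value :: "(complex \<Rightarrow> complex) \<Rightarrow> complex \<Rightarrow> complex \<Rightarrow> bool" where
  "has_boundary_value f \<zeta> l \<longleftrightarrow> ((\<lambda>r::real. f (of_real r * \<zeta>)) \<longlongrightarrow> l) (at_left 1)"

text \<open>
  The boundary function of an element of \<open>H_inf\<close> is its radial limit, which exists almost
  everywhere on the unit circle by Fatou's theorem. Accordingly, the identity
  \<open>f = \<theta> * cnj (\<zeta> * g)\<close> between boundary functions is required to hold at almost every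
  \<open>\<zeta> = cis t\<close>, in the sense that the three radial limits exist there and satisfy it.
  The functions are total on \<open>complex\<close>, but only their values on \<open>unit_disc\<close> matter.
\<close>

definition K_inf :: "(complex \<Rightarrow> complex) \<Rightarrow> (complex \<Rightarrow> complex) set" where
  "K_inf \<theta> = {f \<in> H_inf. \<exists>g \<in> H_inf. AE t\<in>{0..2*pi} in lborel.
     \<exists>u v w. has_boundary_value f (cis t) u \<and> has_boundary_value \<theta> (cis t) v \<and>
             has_boundary_value g (cis t) w \<and> u = v * cnj (cis t * w)}"

definition interpolating :: "(nat \<Rightarrow> complex) \<Rightarrow> (complex \<Rightarrow> complex) set \<Rightarrow> bool" where
  "interpolating w X \<longleftrightarrow>
     (\<forall>\<alpha>::nat \<Rightarrow> complex. bounded (range \<alpha>) \<longrightarrow> (\<exists>f\<in>X. \<forall>n. f (w n) = \<alpha> n))"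

definition pseudohyp :: "complex \<Rightarrow> complex \<Rightarrow> real" where
  "pseudohyp a z = cmod ((z - a) / (1 - cnj a * z))"

definition rho_separated :: "(nat \<Rightarrow> complex) \<Rightarrow> bool" where
  "rho_separated z \<longleftrightarrow> (INF (j, k)\<in>{(j, k). j \<noteq> k}. pseudohyp (z j) (z k)) > 0"

definition blaschke_condition :: "(nat \<Rightarrow> complex) \<Rightarrow> bool" where
  "blaschke_condition a \<longleftrightarrow> summable (\<lambda>j. 1 - cmod (a j))"

definition blaschke_factor :: "complex \<Rightarrow> complex \<Rightarrow> complex" where
  "blaschke_factor a z =
     - (if a = 0 then 1 else of_real (cmod a) / a) * ((z - a) / (1 - cnj a * z))"

text \<open>
  At a point \<open>z = a j\<close> the infinite product has a vanishing factor; \<^const>\<open>prodinf\<close> then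
  yields 0, as the product of the remaining nonzero factors still converges.
\<close>

definition blaschke_product :: "complex \<Rightarrow> (nat \<Rightarrow> complex) \<Rightarrow> complex \<Rightarrow> complex" where
  "blaschke_product c a z = c * (\<Prod>j. blaschke_factor (a j) z)"

end

theory Submission
  imports Defs "HOL-Complex_Analysis.Complex_Analysis"
begin

text \<open>
  For a \<open>\<rho>\<close>-separated Blaschke sequence, being interpolating for \<open>K_inf B\<close> is equivalent to the uniform
  Frostman condition, that the sums of \<open>(1 - \<bar>a\<^sub>j\<bar>\<^sup>2) / \<bar>1 - cnj w * a\<^sub>j\<bar>\<close> are bounded uniformly in \<open>w\<close>, and
  this condition survives a perturbation with \<open>\<rho>(a\<^sub>j, z\<^sub>j) \<le> \<mu> < 1\<close>, because each summand changes
  by at most the factor \<open>1 / (1 - \<mu>)\<^sup>2\<close>.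

  Under the Frostman condition the interpolating function is the explicit series
  \<open>\<Sum>j. \<gamma>\<^sub>j (1 - \<bar>a\<^sub>j\<bar>\<^sup>2) / (1 - cnj a\<^sub>j * z) * B\<^sub>j(z)\<close>, where \<open>B\<^sub>j\<close> omits the \<open>j\<close>-th factor; all radial limits
  exist at every point of the circle by domination.

  Conversely, if \<open>f = B * cnj (\<zeta> * g)\<close> on the circle, then replacing \<open>B\<close> by its \<open>N\<close>-th partial product and
  evaluating by residues shows that \<open>cnj (g w)\<close> is, up to a small multiple of the supremum of \<open>\<bar>g\<bar>\<close>,
  a finite linear combination of the values \<open>f(a\<^sub>j)\<close> for \<open>j < N\<close>. As \<open>g\<close> is bounded, these finitely
  supported functionals are pointwise bounded on bounded sequences, hence uniformly bounded, and their
  coefficients dominate the summands of the Frostman condition.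
\<close>

section \<open>Blaschke factors and partial Blaschke products\<close>

text \<open>The unimodular constant that makes the factor equal to \<open>cmod a\<close> at 0. It is
  kept apart because it enters the residues and the reflection identity on the circle.\<close>

definition phase :: "complex \<Rightarrow> complex" where
  "phase a = - (if a = 0 then 1 else of_real (cmod a) / a)"

lemma blaschke_factor_phase: "blaschke_factor a z = phase a * ((z - a) / (1 - cnj a * z))"
  by (simp add: blaschke_factor_def phase_def)

lemma norm_phase [simp]: "cmod (phase a) = 1"
  by (simp add: phase_def norm_divide)

lemma phase_nz [simp]: "phase a \<noteq> 0"
  using norm_phase[of a] by (metis norm_zero zero_neq_one)

lemma norm_one_minus_ge: "1 - cmod a * cmod z \<le> cmod (1 - cnj a * z)"
  by (metis norm_triangle_ineq2 norm_one norm_mult complex_mod_cnj)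

lemma one_minus_cnj_mult_nz:
  assumes "cmod a < 1" "cmod z \<le> 1"
  shows "1 - cnj a * z \<noteq> 0"
proof -
  have "cmod a * cmod z < 1"
    using assms by (metis mult_left_le norm_ge_zero order_le_less_trans)
  then show ?thesis using norm_one_minus_ge[of a z] by auto
qed

lemma norm_cnj_swap: "cmod (1 - cnj a * z) = cmod (1 - cnj z * a)"
  by (metis complex_cnj_cnj complex_cnj_diff complex_cnj_mult complex_cnj_one complex_mod_cnj mult.commute)

text \<open>Both sides agree after expansion with |x|^2 = \<open>x * cnj x\<close>. The signs of the
  right side give the bound 1 for Blaschke factors on the disc and modulus 1 on the circle.\<close>

lemma moebius_identity:
  "(cmod (1 - cnj a * z))\<^sup>2 - (cmod (z - a))\<^sup>2 = (1 - (cmod a)\<^sup>2) * (1 - (cmod z)\<^sup>2)"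
proof -
  have "complex_of_real ((cmod (1 - cnj a * z))\<^sup>2 - (cmod (z - a))\<^sup>2)
      = of_real ((1 - (cmod a)\<^sup>2) * (1 - (cmod z)\<^sup>2))"
    by (simp only: of_real_diff of_real_mult complex_norm_square of_real_1) (simp add: algebra_simps)
  then show ?thesis using of_real_eq_iff by blast
qed

lemma norm_blaschke_factor: "cmod (blaschke_factor a z) = pseudohyp a z"
  by (simp add: blaschke_factor_phase pseudohyp_def norm_mult norm_divide)

lemma one_minus_pseudohyp_sq:
  assumes "cmod a < 1" "cmod z \<le> 1"
  shows "1 - (pseudohyp a z)\<^sup>2 = (1 - (cmod a)\<^sup>2) * (1 - (cmod z)\<^sup>2) / (cmod (1 - cnj a * z))\<^sup>2"
proof -
  have "cmod (1 - cnj a * z) \<noteq> 0" using one_minus_cnj_mult_nz[OF assms] by simp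
  then show ?thesis
    by (simp add: pseudohyp_def norm_divide power_divide divide_simps flip: moebius_identity)
qed

lemma pseudohyp_le_1:
  assumes "cmod a < 1" "cmod z \<le> 1"
  shows "pseudohyp a z \<le> 1"
proof -
  have "1 - (pseudohyp a z)\<^sup>2 \<ge> 0"
    unfolding one_minus_pseudohyp_sq[OF assms] using assms
    by (intro divide_nonneg_nonneg mult_nonneg_nonneg) (auto simp: power_le_one)
  then show ?thesis by (simp add: abs_square_le_1 pseudohyp_def)
qed

lemma pseudohyp_sym: "pseudohyp a z = pseudohyp z a"
  by (simp add: pseudohyp_def norm_divide norm_minus_commute norm_cnj_swap[of a z])

lemma pseudohyp_nonneg [simp]: "0 \<le> pseudohyp a z"
  by (simp add: pseudohyp_def)

lemma norm_blaschke_factor_le_1: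
  "cmod a < 1 \<Longrightarrow> cmod z \<le> 1 \<Longrightarrow> cmod (blaschke_factor a z) \<le> 1"
  by (simp add: norm_blaschke_factor pseudohyp_le_1)

lemma norm_blaschke_factor_eq_1:
  assumes "cmod a < 1" "cmod z = 1"
  shows "cmod (blaschke_factor a z) = 1"
  using one_minus_pseudohyp_sq[of a z] assms
  by (simp add: norm_blaschke_factor abs_square_eq_1)

lemma blaschke_factor_zero_iff:
  assumes "cmod a < 1" "cmod z \<le> 1"
  shows "blaschke_factor a z = 0 \<longleftrightarrow> z = a"
  using one_minus_cnj_mult_nz[OF assms] by (simp add: blaschke_factor_phase)

lemma blaschke_factor_0: "blaschke_factor a 0 = of_real (cmod a)"
  by (simp add: blaschke_factor_def)

lemma holomorphic_blaschke_factor [holomorphic_intros]: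
  assumes "cmod a < 1" "S \<subseteq> cball 0 1"
  shows "blaschke_factor a holomorphic_on S"
proof -
  have "1 - cnj a * z \<noteq> 0" if "z \<in> S" for z
    using one_minus_cnj_mult_nz[OF assms(1)] that assms(2) by auto
  then have "(\<lambda>z. phase a * ((z - a) / (1 - cnj a * z))) holomorphic_on S"
    by (intro holomorphic_intros) auto
  then show ?thesis by (simp add: blaschke_factor_phase[abs_def])
qed

text \<open>With m = \<open>cmod a\<close>, the difference is
  \<open>- (1 - m) * (a + m * z) / (a * (1 - cnj a * z))\<close>, and
  \<open>cmod (a + m * z) \<le> 2 * m\<close> cancels the division by \<open>a\<close>. The estimate
  stays valid on the circle, where it supplies the majorants for convergence at boundary
  points.\<close>

lemma one_minus_blaschke_factor:
  assumes "cmod a < 1" "cmod z \<le> 1"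
  shows "cmod (blaschke_factor a z - 1) \<le> 2 * (1 - cmod a) / cmod (1 - cnj a * z)"
proof (cases "a = 0")
  case True
  have "cmod (- z - 1) \<le> cmod z + 1" using norm_triangle_ineq4[of "- z" 1] by simp
  then show ?thesis using True assms by (simp add: blaschke_factor_def)
next
  case False
  define m where "m = cmod a"
  have nz: "1 - cnj a * z \<noteq> 0" by (rule one_minus_cnj_mult_nz[OF assms])
  have mm: "of_real m * of_real m = a * cnj a"
    unfolding m_def by (metis complex_norm_square of_real_power power2_eq_square)
  have n1: "cmod (1 - of_real m) = 1 - m"
    using norm_of_real[of "1 - m", where 'a = complex] assms by (simp add: m_def)
  have "blaschke_factor a z - 1 = - ((1 - of_real m) * (a + of_real m * z)) / (a * (1 - cnj a * z))"
  proof -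
    have "blaschke_factor a z - 1 = (- (of_real m * (z - a)) - a * (1 - cnj a * z)) / (a * (1 - cnj a * z))"
      using False nz by (simp add: blaschke_factor_def divide_simps flip: m_def)
    moreover have "- (of_real m * (z - a)) - a * (1 - cnj a * z) = - ((1 - of_real m) * (a + of_real m * z))"
      using mm by algebra
    ultimately show ?thesis by simp
  qed
  also have "cmod \<dots> = (1 - m) * cmod (a + of_real m * z) / (m * cmod (1 - cnj a * z))"
    using n1 by (simp add: norm_mult norm_divide m_def)
  also have "\<dots> \<le> (1 - m) * (2 * m) / (m * cmod (1 - cnj a * z))"
  proof -
    have "cmod (a + of_real m * z) \<le> m + m * cmod z"
      using norm_triangle_ineq[of a "of_real m * z"] by (simp add: norm_mult m_def)
    also have "\<dots> \<le> 2 * m" using assms by (simp add: m_def mult_left_le)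
    finally show ?thesis using assms
      by (intro divide_right_mono mult_left_mono) (auto simp: m_def)
  qed
  finally show ?thesis using False by (simp add: m_def mult.commute)
qed

section \<open>Convergence of products over subsets of the zeros\<close>

definition subproduct :: "(nat \<Rightarrow> complex) \<Rightarrow> nat set \<Rightarrow> complex \<Rightarrow> complex" where
  "subproduct a S z = (\<Prod>j. if j \<in> S then blaschke_factor (a j) z else 1)"

lemma blaschke_product_subproduct: "blaschke_product c a z = c * subproduct a UNIV z"
  by (simp add: blaschke_product_def subproduct_def)

text \<open>All factors have modulus at most 1, so replacing those from index n on by 1 costs at
  most the tail of a summable series. The set \<open>X\<close> is left general: it will be a single
  point, a small closed disc or a closed radius, each with its own majorant \<open>m\<close>. The
  set \<open>S\<close> covers the full product, tails and products with one zero omitted.\<close>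

lemma uniform_limit_subproduct:
  assumes a: "\<And>j. cmod (a j) < 1" and X: "X \<subseteq> cball 0 1"
    and m: "\<And>j z. z \<in> X \<Longrightarrow> (1 - cmod (a j)) / cmod (1 - cnj (a j) * z) \<le> m j" "summable m"
  shows "uniform_limit X (\<lambda>n z. \<Prod>j<n. if j \<in> S then blaschke_factor (a j) z else 1) (subproduct a S) sequentially"
proof -
  define F where "F = (\<lambda>j z. if j \<in> S then blaschke_factor (a j) z else 1)"
  have F1: "cmod (F j z) \<le> 1" if "z \<in> X" for j z
    using X that a norm_blaschke_factor_le_1[of "a j" z] by (auto simp: F_def)
  have "norm (F j z - 1) \<le> 2 * m j" if "z \<in> X" for j z
  proof (cases "j \<in> S")
    case True
    have "norm (F j z - 1) \<le> 2 * ((1 - cmod (a j)) / cmod (1 - cnj (a j) * z))"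
      using True one_minus_blaschke_factor[of "a j" z] a that X by (auto simp: F_def)
    then show ?thesis using m(1)[OF that, of j] by linarith
  next
    case False
    have "0 \<le> (1 - cmod (a j)) / cmod (1 - cnj (a j) * z)" using a[of j] by simp
    then show ?thesis using m(1)[OF that, of j] False by (simp add: F_def)
  qed
  note dF = this
  have s2: "summable (\<lambda>j. 2 * m j)" using m(2) by (rule summable_mult)
  have lim: "(\<lambda>n. \<Prod>j<n. F j z) \<longlonglongrightarrow> subproduct a S z" if "z \<in> X" for z
  proof -
    have "summable (\<lambda>i. norm (F i z - 1))"
      by (rule summable_comparison_test'[OF s2, of 0]) (use dF that in auto)
    then have "convergent_prod (\<lambda>j. F j z)"
      using abs_convergent_prod_conv_summable abs_convergent_prod_imp_convergent_prod by blast
    then show ?thesis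
      using convergent_prod_LIMSEQ[of "\<lambda>j. F j z"]
      unfolding LIMSEQ_lessThan_iff_atMost[where f = "\<lambda>S. \<Prod>j\<in>S. F j z"]
      by (simp add: subproduct_def F_def)
  qed
  have tail: "(\<lambda>n. \<Sum>j. 2 * m (j + n)) \<longlonglongrightarrow> 0"
    using suminf_exist_split2[OF s2] .
  have est: "norm ((\<Prod>j<n. F j z) - subproduct a S z) \<le> (\<Sum>j. 2 * m (j + n))" if "z \<in> X" for n z
  proof -
    have "norm ((\<Prod>j<n. F j z) - (\<Prod>j<k+n. F j z)) \<le> (\<Sum>j. 2 * m (j + n))" for k
    proof -
      \<comment> \<open>Padding with ones brings both products to the same index set, as the
        telescoping estimate for products needs.\<close>
      have "(\<Prod>j<n. F j z) = (\<Prod>j<k+n. if j < n then F j z else 1)"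
        by (rule prod.mono_neutral_cong_left) auto
      then have "norm ((\<Prod>j<n. F j z) - (\<Prod>j<k+n. F j z))
          \<le> (\<Sum>j<k+n. norm ((if j < n then F j z else 1) - F j z))"
        using norm_prod_diff[of "{..<k+n}" "\<lambda>j. if j < n then F j z else 1" "\<lambda>j. F j z"] F1[OF that]
        by simp
      also have "\<dots> = (\<Sum>j\<in>{n..<k+n}. norm ((if j < n then F j z else 1) - F j z))"
        by (rule sum.mono_neutral_right) auto
      also have "\<dots> = (\<Sum>j<k. norm (1 - F (j+n) z))"
        by (rule sum.reindex_bij_witness[of _ "\<lambda>j. j + n" "\<lambda>j. j - n"]) auto
      also have "\<dots> \<le> (\<Sum>j<k. 2 * m (j + n))"
        using dF[OF that] by (intro sum_mono) (simp add: norm_minus_commute)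
      also have "\<dots> \<le> (\<Sum>j. 2 * m (j + n))"
      proof (rule sum_le_suminf)
        show "summable (\<lambda>j. 2 * m (j + n))" using s2 by (rule summable_ignore_initial_segment)
        show "0 \<le> 2 * m (j + n)" for j using dF[OF that] norm_ge_zero order_trans by blast
      qed simp
      finally show ?thesis .
    qed
    moreover have "(\<lambda>k. norm ((\<Prod>j<n. F j z) - (\<Prod>j<k+n. F j z))) \<longlonglongrightarrow> norm ((\<Prod>j<n. F j z) - subproduct a S z)"
      by (intro tendsto_intros LIMSEQ_ignore_initial_segment[OF lim[OF that]])
    ultimately show ?thesis by (intro LIMSEQ_le_const2) auto
  qed
  have "uniform_limit X (\<lambda>n z. \<Prod>j<n. F j z) (subproduct a S) sequentially"
  proof (rule uniform_limitI)
    fix e :: real assume "e > 0"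
    from order_tendstoD(2)[OF tail this] have "\<forall>\<^sub>F n in sequentially. (\<Sum>j. 2 * m (j + n)) < e" .
    then show "\<forall>\<^sub>F n in sequentially. \<forall>x\<in>X. dist (\<Prod>j<n. F j x) (subproduct a S x) < e"
      proof eventually_elim
      case (elim n)
      then show ?case using est unfolding dist_norm by (meson le_less_trans)
    qed
  qed
  then show ?thesis by (simp add: F_def)
qed

locale disc_sequence =
  fixes a :: "nat \<Rightarrow> complex"
  assumes in_disc: "cmod (a j) < 1"
begin

text \<open>A sufficient condition for absolute convergence of the product at a point of the closed
  disc. The Blaschke condition gives it in the open disc; on the circle it will come from the
  Frostman condition.\<close>

definition regular_at :: "complex \<Rightarrow> bool" where
  "regular_at z \<longleftrightarrow> cmod z \<le> 1 \<and> summable (\<lambda>j. (1 - cmod (a j)) / cmod (1 - cnj (a j) * z))"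

lemma subproduct_LIMSEQ:
  assumes "regular_at z"
  shows "(\<lambda>n. \<Prod>j<n. if j \<in> S then blaschke_factor (a j) z else 1) \<longlonglongrightarrow> subproduct a S z"
  using tendsto_uniform_limitI[OF uniform_limit_subproduct[of a "{z}", OF in_disc, of
      "\<lambda>j. (1 - cmod (a j)) / cmod (1 - cnj (a j) * z)" S], of z] assms
  by (auto simp: regular_at_def)

lemma norm_subproduct_le_1:
  assumes "regular_at z"
  shows "cmod (subproduct a S z) \<le> 1"
proof (rule LIMSEQ_le_const2)
  show "(\<lambda>n. cmod (\<Prod>j<n. if j \<in> S then blaschke_factor (a j) z else 1)) \<longlonglongrightarrow> cmod (subproduct a S z)"
    by (intro tendsto_norm subproduct_LIMSEQ assms)
  have "cmod (\<Prod>j<n. if j \<in> S then blaschke_factor (a j) z else 1) \<le> 1" for n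
    unfolding prod_norm[symmetric]
    using assms in_disc norm_blaschke_factor_le_1 by (intro prod_le_1) (auto simp: regular_at_def)
  then show "\<exists>N. \<forall>n\<ge>N. cmod (\<Prod>j<n. if j \<in> S then blaschke_factor (a j) z else 1) \<le> 1" by blast
qed

lemma subproduct_split:
  assumes "regular_at z" "S \<inter> T = {}"
  shows "subproduct a (S \<union> T) z = subproduct a S z * subproduct a T z"
proof (rule LIMSEQ_unique[OF subproduct_LIMSEQ[OF assms(1)]])
  have "(\<Prod>j<n. if j \<in> S \<union> T then blaschke_factor (a j) z else 1) =
    (\<Prod>j<n. if j \<in> S then blaschke_factor (a j) z else 1) * (\<Prod>j<n. if j \<in> T then blaschke_factor (a j) z else 1)" for n
    unfolding prod.distrib[symmetric] using assms(2) by (intro prod.cong) auto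
  then show "(\<lambda>n. \<Prod>j<n. if j \<in> S \<union> T then blaschke_factor (a j) z else 1) \<longlonglongrightarrow> subproduct a S z * subproduct a T z"
    by (simp only:) (intro tendsto_mult subproduct_LIMSEQ assms)
qed

lemma subproduct_finite: "finite S \<Longrightarrow> subproduct a S z = (\<Prod>j\<in>S. blaschke_factor (a j) z)"
  unfolding subproduct_def by (subst prodinf_finite[of S]) auto

lemma subproduct_zero:
  assumes "regular_at (a k)" "k \<in> S"
  shows "subproduct a S (a k) = 0"
proof -
  have "subproduct a ({k} \<union> (S - {k})) (a k) = 0"
    by (subst subproduct_split[OF assms(1)]) (auto simp: subproduct_finite blaschke_factor_phase)
  moreover have "{k} \<union> (S - {k}) = S" using assms by auto
  ultimately show ?thesis by simp
qed

end

locale blaschke_sequence = disc_sequence +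
  assumes blaschke: "summable (\<lambda>j. 1 - cmod (a j))"
begin

lemma term_bound:
  assumes "cmod z \<le> r" "r < 1"
  shows "(1 - cmod (a j)) / cmod (1 - cnj (a j) * z) \<le> (1 - cmod (a j)) / (1 - r)"
proof (rule frac_le)
  have "cmod (a j) * cmod z \<le> r"
    using in_disc[of j] assms mult_mono[of "cmod (a j)" 1 "cmod z" r] by simp
  then show "1 - r \<le> cmod (1 - cnj (a j) * z)" using norm_one_minus_ge[of "a j" z] by linarith
qed (use in_disc[of j] assms in auto)

lemma regular_in_disc:
  assumes "cmod z < 1"
  shows "regular_at z"
proof -
  have "summable (\<lambda>j. (1 - cmod (a j)) / cmod (1 - cnj (a j) * z))"
  proof (rule summable_comparison_test'[OF summable_divide[OF blaschke, of "1 - cmod z"], of 0])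
    fix j
    have "0 \<le> (1 - cmod (a j)) / cmod (1 - cnj (a j) * z)" using in_disc[of j] by simp
    then show "norm ((1 - cmod (a j)) / cmod (1 - cnj (a j) * z)) \<le> (1 - cmod (a j)) / (1 - cmod z)"
      using term_bound[OF order_refl assms, of j] by simp
  qed
  then show ?thesis using assms by (simp add: regular_at_def)
qed

lemma holomorphic_subproduct: "subproduct a S holomorphic_on unit_disc"
proof (rule holomorphic_uniform_sequence[where f = "\<lambda>n z. \<Prod>j<n. if j \<in> S then blaschke_factor (a j) z else 1"])
  have hf: "(\<lambda>z. if j \<in> S then blaschke_factor (a j) z else 1) holomorphic_on unit_disc" for j
    using holomorphic_blaschke_factor[OF in_disc, of unit_disc j] by (cases "j \<in> S") auto
  show "(\<lambda>z. \<Prod>j<n. if j \<in> S then blaschke_factor (a j) z else 1) holomorphic_on unit_disc" for n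
    by (intro holomorphic_on_prod hf)
  fix z assume "z \<in> unit_disc"
  define d where "d = (1 - cmod z) / 2"
  have d: "0 < d" "cmod z + d < 1" using \<open>z \<in> unit_disc\<close> by (auto simp: d_def field_simps)
  have le: "cmod x \<le> cmod z + d" if "x \<in> cball z d" for x
    using that norm_triangle_ineq2[of x z] by (auto simp: dist_norm norm_minus_commute)
  have "uniform_limit (cball z d) (\<lambda>n z. \<Prod>j<n. if j \<in> S then blaschke_factor (a j) z else 1) (subproduct a S) sequentially"
  proof (rule uniform_limit_subproduct[where m = "\<lambda>j. (1 - cmod (a j)) / (1 - (cmod z + d))"])
    show "cball z d \<subseteq> cball 0 1" using le d(2) by force
    show "(1 - cmod (a j)) / cmod (1 - cnj (a j) * x) \<le> (1 - cmod (a j)) / (1 - (cmod z + d))" if "x \<in> cball z d" for j x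
      by (rule term_bound[OF le[OF that] d(2)])
  qed (use in_disc blaschke in \<open>auto intro: summable_divide\<close>)
  moreover have "cball z d \<subseteq> unit_disc" using le d(2) by force
  ultimately show "\<exists>d>0. cball z d \<subseteq> unit_disc \<and> uniform_limit (cball z d)
     (\<lambda>n z. \<Prod>j<n. if j \<in> S then blaschke_factor (a j) z else 1) (subproduct a S) sequentially"
    using d by blast
qed simp

text \<open>At 0 each factor is the real number \<open>cmod (a j)\<close>, so the tails of the
  Blaschke sum control the error. By the mean value property the value at 0 is the mean over
  circles, so the tail products are close to 1 in mean.\<close>

lemma subproduct_tail_at_0: "(\<lambda>N. subproduct a {N..} 0) \<longlonglongrightarrow> 1"
proof -
  have reg: "regular_at 0" by (simp add: regular_in_disc)
  have norm1: "cmod (1 - blaschke_factor (a j) 0) = 1 - cmod (a j)" for j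
  proof -
    have "1 - blaschke_factor (a j) 0 = of_real (1 - cmod (a j))" by (simp add: blaschke_factor_0)
    then show ?thesis using in_disc[of j] by (metis abs_of_nonneg diff_ge_0_iff_ge less_imp_le norm_of_real)
  qed
  have est: "norm (1 - subproduct a {N..} 0) \<le> (\<Sum>j. 1 - cmod (a (j + N)))" for N
  proof -
    let ?F = "\<lambda>j. if j \<in> {N..} then blaschke_factor (a j) 0 else 1"
    have "norm (1 - (\<Prod>j<k+N. ?F j)) \<le> (\<Sum>j. 1 - cmod (a (j + N)))" for k
    proof -
      have "norm ((\<Prod>j<k+N. 1) - (\<Prod>j<k+N. ?F j)) \<le> (\<Sum>j<k+N. norm (1 - ?F j))"
        using in_disc by (intro norm_prod_diff) (auto simp: blaschke_factor_0 less_imp_le)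
      also have "\<dots> = (\<Sum>j\<in>{N..<k+N}. norm (1 - ?F j))"
        by (rule sum.mono_neutral_right) auto
      also have "\<dots> = (\<Sum>j<k. 1 - cmod (a (j + N)))"
        by (rule sum.reindex_bij_witness[of _ "\<lambda>j. j + N" "\<lambda>j. j - N"]) (auto simp: norm1)
      also have "\<dots> \<le> (\<Sum>j. 1 - cmod (a (j + N)))"
        using in_disc blaschke less_imp_le
        by (intro sum_le_suminf summable_ignore_initial_segment[of "\<lambda>j. 1 - cmod (a j)"]) auto
      finally show ?thesis by simp
    qed
    moreover have "(\<lambda>k. norm (1 - (\<Prod>j<k+N. ?F j))) \<longlonglongrightarrow> norm (1 - subproduct a {N..} 0)"
      by (intro tendsto_intros LIMSEQ_ignore_initial_segment[OF subproduct_LIMSEQ[OF reg]])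
    ultimately show ?thesis by (intro LIMSEQ_le_const2) auto
  qed
  have "(\<lambda>N. 1 - subproduct a {N..} 0) \<longlonglongrightarrow> 0"
    by (rule Lim_null_comparison[OF _ suminf_exist_split2[OF blaschke]]) (use est in auto)
  from tendsto_diff[OF tendsto_const[of 1] this] show ?thesis by simp
qed

end

section \<open>Recovering the companion function by residues\<close>

text \<open>The residue theorem with dz = i z dt, which is the origin of the extra factor z in the
  integrand. The form over \<open>t\<close> permits limits as the radius grows to 1.\<close>

lemma circle_integral_residues:
  assumes hol: "F holomorphic_on unit_disc - pts" and fin: "finite pts"
    and pts: "pts \<subseteq> ball 0 r" and r: "0 < r" "r < 1"
  shows "integral {0..2*pi} (\<lambda>t. F (of_real r * cis t) * (of_real r * cis t)) = 2 * pi * (\<Sum>p\<in>pts. residue F p)"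
proof -
  have sph: "sphere 0 r \<subseteq> unit_disc - pts" using pts r by auto
  have "contour_integral (circlepath 0 r) F =
      2 * pi * \<i> * (\<Sum>p\<in>pts. winding_number (circlepath 0 r) p * residue F p)"
  proof (rule Residue_theorem[OF _ _ fin hol])
    show "path_image (circlepath 0 r) \<subseteq> unit_disc - pts" using sph r by simp
    show "\<forall>z. z \<notin> unit_disc \<longrightarrow> winding_number (circlepath 0 r) z = 0"
    proof (intro allI impI)
      fix z :: complex assume "z \<notin> unit_disc"
      then show "winding_number (circlepath 0 r) z = 0"
        using r by (intro winding_number_zero_outside[of _ "cball 0 r"]) auto
    qed
  qed auto
  also have "(\<Sum>p\<in>pts. winding_number (circlepath 0 r) p * residue F p) = (\<Sum>p\<in>pts. residue F p)"
    using pts by (intro sum.cong refl) (subst winding_number_circlepath, auto)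
  finally have c: "contour_integral (circlepath 0 r) F = 2 * pi * \<i> * (\<Sum>p\<in>pts. residue F p)" .
  have "contour_integral (circlepath 0 r) F = integral {0..2*pi} (\<lambda>t. \<i> * (F (of_real r * cis t) * (of_real r * cis t)))"
    unfolding circlepath_def by (subst contour_integral_part_circlepath_eq) (auto simp: mult_ac)
  also have "\<dots> = \<i> * integral {0..2*pi} (\<lambda>t. F (of_real r * cis t) * (of_real r * cis t))"
    by simp
  finally show ?thesis using c by (simp add: mult.assoc)
qed

text \<open>Dominated convergence; the functions are set to 0 on the exceptional null set, which
  leaves the integrals unchanged and makes the convergence hold everywhere.\<close>

lemma integral_tendsto_0:
  fixes Y :: "nat \<Rightarrow> real \<Rightarrow> real"
  assumes cont: "\<And>m. continuous_on {0..2*pi} (Y m)"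
    and bd: "\<And>m t. t \<in> {0..2*pi} \<Longrightarrow> \<bar>Y m t\<bar> \<le> C"
    and ae: "AE t\<in>{0..2*pi} in lborel. (\<lambda>m. Y m t) \<longlonglongrightarrow> 0"
  shows "(\<lambda>m. integral {0..2*pi} (Y m)) \<longlonglongrightarrow> 0"
proof -
  from ae obtain N where N: "N \<in> null_sets lborel" "{t \<in> space lborel. \<not> (t \<in> {0..2*pi} \<longrightarrow> (\<lambda>m. Y m t) \<longlonglongrightarrow> 0)} \<subseteq> N"
    unfolding eventually_ae_filter by blast
  have neg: "negligible N" using N(1) by (simp add: negligible_iff_null_sets null_sets_completionI)
  define Z where "Z = (\<lambda>m t. if t \<in> N then 0 else Y m t)"
  have eq: "integral {0..2*pi} (Z m) = integral {0..2*pi} (Y m)" for m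
    by (rule integral_spike[OF neg]) (auto simp: Z_def)
  have "(\<lambda>m. integral {0..2*pi} (Z m)) \<longlonglongrightarrow> integral {0..2*pi} (\<lambda>_. 0)"
  proof (rule dominated_convergence)
    show "Z m integrable_on {0..2*pi}" for m
      by (rule integrable_spike[OF integrable_continuous_interval[OF cont] neg]) (auto simp: Z_def)
    show "(\<lambda>_. C) integrable_on {0..2*pi}" by (rule integrable_const_ivl)
    show "norm (Z m t) \<le> C" if "t \<in> {0..2*pi}" for m t
      using bd[OF that, of m] by (auto simp: Z_def)
    show "(\<lambda>m. Z m t) \<longlonglongrightarrow> 0" if "t \<in> {0..2*pi}" for t
      using N(2) that by (cases "t \<in> N") (auto simp: Z_def)
  qed
  then show ?thesis by (simp add: eq)
qed

text \<open>For \<open>\<rho>\<close> in the closed disc the square of the distance to 1 is at most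
  \<open>2 * (1 - Re \<rho>)\<close>; the inequality of means with weight \<open>s\<close> removes
  the square root. The result is affine in \<open>Re \<rho>\<close>, so its mean over a circle is
  known exactly for analytic \<open>\<rho>\<close>.\<close>

lemma dist_one_le_Re:
  assumes "cmod \<rho> \<le> 1" "s > 0"
  shows "cmod (1 - \<rho>) \<le> s / 2 + (1 - Re \<rho>) / s"
proof -
  have "(cmod (1 - \<rho>))\<^sup>2 = 1 - 2 * Re \<rho> + (cmod \<rho>)\<^sup>2"
    by (simp only: cmod_power2) (simp add: power2_eq_square algebra_simps)
  also have "\<dots> \<le> 2 - 2 * Re \<rho>" using assms(1) by (simp add: power_le_one)
  finally have "(cmod (1 - \<rho>))\<^sup>2 \<le> 2 * (1 - Re \<rho>)" by simp
  moreover have "2 * s * cmod (1 - \<rho>) \<le> s\<^sup>2 + (cmod (1 - \<rho>))\<^sup>2"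
    by (metis add.commute mult.assoc mult.commute sum_squares_bound)
  ultimately have "2 * s * cmod (1 - \<rho>) \<le> s\<^sup>2 + 2 * (1 - Re \<rho>)" by linarith
  then show ?thesis using assms(2) by (simp add: field_simps power2_eq_square)
qed

section \<open>Residue functionals and the pairing with the companion function\<close>

context blaschke_sequence
begin

definition partial_product :: "complex \<Rightarrow> nat \<Rightarrow> complex \<Rightarrow> complex" where
  "partial_product b N z = b * (\<Prod>j<N. blaschke_factor (a j) z)"

text \<open>The multiplier of \<open>f (a j)\<close> in the residue at \<open>a j\<close> of
  \<open>f\<close> divided by the partial product and by \<open>1 - cnj w * z\<close>. The numerator
  is the denominator of the j-th Blaschke factor at its own zero.\<close>

definition residue_coeff :: "complex \<Rightarrow> nat \<Rightarrow> complex \<Rightarrow> nat \<Rightarrow> complex" where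
  "residue_coeff b N w j = (1 - of_real ((cmod (a j))\<^sup>2)) /
     ((1 - cnj w * a j) * (b * phase (a j) * (\<Prod>i\<in>{..<N} - {j}. blaschke_factor (a i) (a j))))"

text \<open>The remaining Blaschke factors stand in the denominator and have modulus at most 1, so
  dropping them only lowers the value.\<close>

lemma norm_residue_coeff_ge:
  assumes "cmod b = 1" "inj a" "cmod w < 1"
  shows "(1 - (cmod (a j))\<^sup>2) / cmod (1 - cnj w * a j) \<le> cmod (residue_coeff b N w j)"
proof -
  define q where "q = (\<Prod>i\<in>{..<N} - {j}. blaschke_factor (a i) (a j))"
  \<comment> \<open>Distinct zeros keep \<open>q\<close> nonzero; otherwise division would return 0
    and the lower bound would fail.\<close>
  have q0: "q \<noteq> 0"
    using assms(2) blaschke_factor_zero_iff[OF in_disc less_imp_le[OF in_disc]]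
    by (auto simp: q_def inj_def)
  have q1: "cmod q \<le> 1"
    unfolding q_def prod_norm[symmetric]
    using norm_blaschke_factor_le_1[OF in_disc less_imp_le[OF in_disc]] by (intro prod_le_1) auto
  have sq: "(cmod (a j))\<^sup>2 \<le> 1" using in_disc[of j] by (simp add: power_le_one less_imp_le)
  have n1: "cmod (1 - of_real ((cmod (a j))\<^sup>2)) = 1 - (cmod (a j))\<^sup>2"
    using norm_of_real[of "1 - (cmod (a j))\<^sup>2", where 'a = complex] sq by simp
  have nz: "1 - cnj w * a j \<noteq> 0" using one_minus_cnj_mult_nz[of w "a j"] assms in_disc[of j] by simp
  have "cmod (residue_coeff b N w j) = (1 - (cmod (a j))\<^sup>2) / (cmod (1 - cnj w * a j) * cmod q)"
    unfolding residue_coeff_def q_def[symmetric] by (simp only: norm_divide norm_mult n1 assms(1) norm_phase mult_1)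
  also have "\<dots> \<ge> (1 - (cmod (a j))\<^sup>2) / cmod (1 - cnj w * a j)"
    using sq nz q0 q1 by (intro divide_left_mono) (auto intro: mult_left_le)
  finally show ?thesis .
qed

lemma holomorphic_partial_product: "partial_product b N holomorphic_on cball 0 1"
  unfolding partial_product_def[abs_def]
  by (intro holomorphic_intros) (use in_disc in auto)

lemma partial_product_zero:
  "cmod b = 1 \<Longrightarrow> cmod z \<le> 1 \<Longrightarrow> partial_product b N z = 0 \<longleftrightarrow> z \<in> a ` {..<N}"
  using blaschke_factor_zero_iff[OF in_disc] by (auto simp: partial_product_def)

lemma norm_partial_product_circle:
  "cmod b = 1 \<Longrightarrow> cmod z = 1 \<Longrightarrow> cmod (partial_product b N z) = 1"
  using norm_blaschke_factor_eq_1[OF in_disc] by (simp add: partial_product_def norm_mult prod_norm[symmetric])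

lemma blaschke_product_split:
  assumes "cmod z < 1"
  shows "blaschke_product b a z = partial_product b N z * subproduct a {N..} z"
proof -
  have "subproduct a ({..<N} \<union> {N..}) z = subproduct a {..<N} z * subproduct a {N..} z"
    by (rule subproduct_split[OF regular_in_disc[OF assms]]) auto
  moreover have "{..<N} \<union> {N..} = (UNIV :: nat set)" by auto
  ultimately show ?thesis
    by (simp add: blaschke_product_subproduct partial_product_def subproduct_finite)
qed

text \<open>Injectivity makes the zero of the partial product simple. Splitting off
  \<open>z - a j\<close> leaves a function \<open>H\<close> that is holomorphic near
  \<open>a j\<close>, and the residue is its value there.\<close>

lemma residue_at_zero:
  assumes f: "f holomorphic_on unit_disc" and "cmod b = 1" "inj a" "cmod w < 1" "j < N"
  shows "residue (\<lambda>z. f z / (partial_product b N z * (1 - cnj w * z))) (a j) = f (a j) * residue_coeff b N w j"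
proof -
  define H where "H = (\<lambda>z. f z * (1 - cnj (a j) * z) /
     ((1 - cnj w * z) * (b * phase (a j) * (\<Prod>i\<in>{..<N} - {j}. blaschke_factor (a i) z))))"
  have eq: "f z / (partial_product b N z * (1 - cnj w * z)) = H z / (z - a j)" for z
  proof -
    have "partial_product b N z = b * (blaschke_factor (a j) z * (\<Prod>i\<in>{..<N} - {j}. blaschke_factor (a i) z))"
      unfolding partial_product_def using assms(5) by (subst prod.remove[of _ j]) auto
    then show ?thesis by (simp add: H_def blaschke_factor_phase[of "a j"] mult_ac)
  qed
  let ?S = "unit_disc - a ` ({..<N} - {j})"
  have "residue (\<lambda>z. H z / (z - a j)) (a j) = H (a j)"
  proof (rule residue_simple)
    show "open ?S" by (intro open_Diff finite_imp_closed) auto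
    show "a j \<in> ?S" using in_disc[of j] assms(3) by (auto simp: inj_def)
    have "1 - cnj w * z \<noteq> 0" if "z \<in> ?S" for z
      using one_minus_cnj_mult_nz[of w z] assms that by auto
    moreover have "(\<Prod>i\<in>{..<N} - {j}. blaschke_factor (a i) z) \<noteq> 0" if "z \<in> ?S" for z
      using that blaschke_factor_zero_iff[OF in_disc, of z] by auto
    moreover have "b \<noteq> 0" using assms(2) by auto
    ultimately show "H holomorphic_on ?S"
      unfolding H_def
      by (intro holomorphic_intros holomorphic_on_subset[OF f]) (use in_disc in auto)
  qed
  also have "H (a j) = f (a j) * residue_coeff b N w j"
  proof -
    have "1 - cnj (a j) * a j = 1 - of_real ((cmod (a j))\<^sup>2)"
      by (simp only: complex_norm_square mult.commute)
    then show ?thesis by (simp only: H_def residue_coeff_def times_divide_eq_right)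
  qed
  finally show ?thesis by (simp only: eq)
qed

text \<open>
  On the circle \<open>f = B * cnj (\<zeta> * g)\<close> gives \<open>cnj g - \<zeta> f / P = cnj g * (1 - B / P)\<close> for the partial product
  \<open>P\<close>. The remaining factor is small in mean because \<open>B / P\<close> is bounded by 1 and has mean \<open>R 0\<close>, where
  \<open>R\<close> is the tail product. Only the positive part \<open>Y\<close> of the excess over this bound is passed to the
  limit, so that boundary functions are never integrated.
\<close>

lemma pairing_estimate:
  assumes inj: "inj a" and b: "cmod b = 1" and f: "f \<in> H_inf" and g: "g \<in> H_inf"
    and ae: "AE t\<in>{0..2*pi} in lborel. \<exists>u v y. has_boundary_value f (cis t) u \<and>
       has_boundary_value (blaschke_product b a) (cis t) v \<and>
       has_boundary_value g (cis t) y \<and> u = v * cnj (cis t * y)"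
    and G: "\<And>z. z \<in> unit_disc \<Longrightarrow> cmod (g z) \<le> G" and w: "cmod w < 1" and s: "s > 0"
  shows "cmod (cnj (g w) - (\<Sum>j<N. f (a j) * residue_coeff b N w j))
     \<le> G / (1 - cmod w) * (s / 2 + (1 - Re (subproduct a {N..} 0)) / s)"
proof -
  let ?P = "partial_product b N" and ?R = "subproduct a {N..}"
  define A where "A = G / (1 - cmod w)"
  \<comment> \<open>\<open>E\<close> is the bound of \<open>dist_one_le_Re\<close> scaled by
    \<open>A\<close>, where \<open>A\<close> bounds \<open>g\<close> divided by
    \<open>1 - cnj w * \<zeta>\<close> on the circle.\<close>
  define E where "E = (\<lambda>\<rho>::complex. A * (s / 2 + (1 - Re \<rho>) / s))"
  have G0: "0 \<le> G" using order_trans[OF norm_ge_zero G[of 0]] by simp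
  have A0: "0 \<le> A" using G0 w by (simp add: A_def)
  have fh: "f holomorphic_on unit_disc" and gh: "g holomorphic_on unit_disc"
    using f g by (auto simp: H_inf_def)
  obtain Fb where Fb: "\<And>z. z \<in> unit_disc \<Longrightarrow> cmod (f z) \<le> Fb"
    using f unfolding H_inf_def bounded_iff by blast
  have Fb0: "0 \<le> Fb" using order_trans[OF norm_ge_zero Fb[of 0]] by simp
  have Rh: "?R holomorphic_on unit_disc" by (rule holomorphic_subproduct)
  have R1: "cmod (?R z) \<le> 1" if "cmod z < 1" for z
    by (rule norm_subproduct_le_1[OF regular_in_disc[OF that]])
  have Pc: "continuous_on (cball 0 1) ?P"
    by (rule holomorphic_on_imp_continuous_on[OF holomorphic_partial_product])

  \<comment> \<open>\<open>r0\<close> lies halfway between 1 and the largest modulus among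
    \<open>w\<close> and the first \<open>N\<close> zeros, so circles of radius at least
    \<open>r0\<close> enclose all poles; inserting 0 makes \<open>r0\<close> positive.\<close>
  define Q where "Q = insert 0 (insert (cmod w) ((\<lambda>j. cmod (a j)) ` {..<N}))"
  have Q: "finite Q" "Q \<noteq> {}" "\<And>q. q \<in> Q \<Longrightarrow> q < 1" using w in_disc by (auto simp: Q_def)
  define r0 where "r0 = (Max Q + 1) / 2"
  have MaxQ: "Max Q < 1" using Q Max_in by blast
  have r0Q: "q < r0" if "q \<in> Q" for q
    using Max_ge[OF Q(1) that] MaxQ by (simp add: r0_def)
  have r0: "0 < r0" "r0 < 1" "cmod w < r0" "\<And>j. j < N \<Longrightarrow> cmod (a j) < r0"
    using r0Q MaxQ by (auto simp: Q_def r0_def)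
  \<comment> \<open>Radii that start at \<open>r0\<close> and approach 1 strictly from below, so
    that radial limits become limits of sequences.\<close>
  define r where "r = (\<lambda>m::nat. 1 - (1 - r0) / real (Suc m))"
  have r: "r0 \<le> r m" "r m < 1" for m
  proof -
    have "(1 - r0) / real (Suc m) \<le> (1 - r0) / 1"
      using r0(2) by (intro divide_left_mono) auto
    then show "r0 \<le> r m" by (simp add: r_def)
    show "r m < 1" using r0(2) by (simp add: r_def)
  qed
  have rpos: "0 < r m" for m using r(1)[of m] r0(1) by linarith
  have rlim: "filterlim r (at_left 1) sequentially"
  proof (rule tendsto_imp_filterlim_at_left)
    show "r \<longlonglongrightarrow> 1" unfolding r_def
      using tendsto_diff[OF tendsto_const[of 1] LIMSEQ_Suc[OF lim_const_over_n[of "1 - r0"]]] by simp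
  qed (use r in auto)
  define x where "x = (\<lambda>m t. of_real (r m) * cis t)"
  have nx: "cmod (x m t) = r m" for m t using rpos[of m] by (simp add: x_def norm_mult)
  have xD: "x m t \<in> unit_disc" for m t using nx r by simp
  have xcb: "x m t \<in> cball 0 1" for m t using nx[of m t] r(2)[of m] by simp
  have nx1: "cmod (x m t) \<le> 1" for m t using xcb[of m t] by simp
  have xne: "x m t \<noteq> 0" for m t using nx rpos by (metis less_irrefl norm_zero)
  have xc: "continuous_on {0..2*pi} (x m)" for m unfolding x_def by (intro continuous_intros)

  \<comment> \<open>The partial product has no zero on the compact annulus between \<open>r0\<close>
    and 1, so its modulus has a positive minimum. This keeps \<open>X2\<close> bounded uniformly in
    the radius.\<close>
  obtain \<delta> where \<delta>: "\<delta> > 0" "\<And>z. r0 \<le> cmod z \<Longrightarrow> cmod z \<le> 1 \<Longrightarrow> \<delta> \<le> cmod (?P z)"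
  proof -
    let ?K = "cball 0 1 - ball (0::complex) r0"
    have "compact ?K" by (intro compact_diff) auto
    moreover have "1 \<in> ?K" using r0 by auto
    moreover have "continuous_on ?K (\<lambda>z. cmod (?P z))"
      by (intro continuous_on_norm continuous_on_subset[OF Pc]) auto
    ultimately obtain z0 where z0: "z0 \<in> ?K" "\<And>z. z \<in> ?K \<Longrightarrow> cmod (?P z0) \<le> cmod (?P z)"
      using continuous_attains_inf[of ?K "\<lambda>z. cmod (?P z)"] by blast
    have "?P z0 \<noteq> 0" using partial_product_zero[OF b, of z0 N] z0(1) r0(4) by force
    then show ?thesis using that[of "cmod (?P z0)"] z0(2) by auto
  qed
  have Pne: "?P (x m t) \<noteq> 0" for m t
    using \<delta>(2)[of "x m t"] \<delta>(1) nx[of m t] r(1)[of m] nx1[of m t] by auto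
  have wne: "1 - cnj w * z \<noteq> 0" if "cmod z \<le> 1" for z
    by (rule one_minus_cnj_mult_nz[OF w that])
  have xw: "x m t \<noteq> w" for m t using nx[of m t] r(1)[of m] r0(3) by auto

  \<comment> \<open>\<open>X1\<close> is the Cauchy integrand that recovers \<open>g w\<close>, and
    \<open>X2\<close> has its residues at the zeros. Conjugating \<open>X1\<close> makes the two
    comparable on the circle, where \<open>cnj \<zeta>\<close> is the inverse of
    \<open>\<zeta>\<close>.\<close>
  define X1 where "X1 = (\<lambda>m t. g (x m t) * x m t / (x m t - w))"
  define X2 where "X2 = (\<lambda>m t. f (x m t) * x m t / (?P (x m t) * (1 - cnj w * x m t)))"
  define X where "X = (\<lambda>m t. cnj (X1 m t) - X2 m t)"
  define Y where "Y = (\<lambda>m t. max 0 (cmod (X m t) - E (?R (x m t))))"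
  have cmp: "continuous_on {0..2*pi} (\<lambda>t. h (x m t))" if "h holomorphic_on unit_disc" for h m
    by (rule continuous_on_compose2[OF holomorphic_on_imp_continuous_on[OF that] xc]) (rule image_subsetI, rule xD)
  have Pcx: "continuous_on {0..2*pi} (\<lambda>t. ?P (x m t))" for m
    by (rule continuous_on_compose2[OF Pc xc]) (rule image_subsetI, rule xcb)
  have c1: "continuous_on {0..2*pi} (X1 m)" for m
    unfolding X1_def using xw by (intro continuous_intros cmp[OF gh] xc) auto
  have c2: "continuous_on {0..2*pi} (X2 m)" for m
    unfolding X2_def using Pne wne[OF nx1] by (intro continuous_intros cmp[OF fh] xc Pcx) auto
  have cX: "continuous_on {0..2*pi} (X m)" for m
    unfolding X_def by (intro continuous_intros c1 c2)
  have cE: "continuous_on {0..2*pi} (\<lambda>t. E (?R (x m t)))" for m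
    unfolding E_def using s by (intro continuous_intros cmp[OF Rh]) auto
  have cY: "continuous_on {0..2*pi} (Y m)" for m
    unfolding Y_def by (intro continuous_intros cX cE)

  have i1: "integral {0..2*pi} (X1 m) = 2 * pi * g w" for m
  proof -
    have "(\<lambda>z. g z / (z - w)) holomorphic_on unit_disc - {w}"
      by (intro holomorphic_intros holomorphic_on_subset[OF gh]) auto
    moreover have "cmod w < r m" using r0(3) r(1)[of m] by linarith
    ultimately have "integral {0..2*pi} (X1 m) = 2 * pi * residue (\<lambda>z. g z / (z - w)) w"
      using circle_integral_residues[of "\<lambda>z. g z / (z - w)" "{w}" "r m"] r(2) rpos
      by (simp add: X1_def x_def)
    also have "residue (\<lambda>z. g z / (z - w)) w = g w"
      using w by (intro residue_simple[OF _ _ gh]) auto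
    finally show ?thesis .
  qed
  have i2: "integral {0..2*pi} (X2 m) = 2 * pi * (\<Sum>j<N. f (a j) * residue_coeff b N w j)" for m
  proof -
    let ?F = "\<lambda>z. f z / (?P z * (1 - cnj w * z))"
    have "?F holomorphic_on unit_disc - a ` {..<N}"
      using partial_product_zero[OF b] wne
      by (intro holomorphic_intros holomorphic_on_subset[OF fh] holomorphic_on_subset[OF holomorphic_partial_product]) auto
    moreover have "cmod (a j) < r m" if "j < N" for j using r0(4)[OF that] r(1)[of m] by linarith
    then have "a ` {..<N} \<subseteq> ball 0 (r m)" by auto
    ultimately have "integral {0..2*pi} (\<lambda>t. ?F (x m t) * x m t) = 2 * pi * (\<Sum>p\<in>a ` {..<N}. residue ?F p)"
      unfolding x_def by (intro circle_integral_residues rpos r) auto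
    also have "(\<Sum>p\<in>a ` {..<N}. residue ?F p) = (\<Sum>j<N. residue ?F (a j))"
      using inj by (subst sum.reindex) (auto simp: inj_def inj_on_def)
    also have "\<dots> = (\<Sum>j<N. f (a j) * residue_coeff b N w j)"
      by (intro sum.cong refl residue_at_zero[OF fh b inj w]) auto
    finally show ?thesis by (simp add: X2_def)
  qed
  \<comment> \<open>The mean value property, read off from the residue of \<open>?R z / z\<close> at
    0.\<close>
  have i3: "integral {0..2*pi} (\<lambda>t. ?R (x m t)) = 2 * pi * ?R 0" for m
  proof -
    have "(\<lambda>z. ?R z / (z - 0)) holomorphic_on unit_disc - {0}"
      by (intro holomorphic_intros holomorphic_on_subset[OF Rh]) auto
    from circle_integral_residues[OF this, of "r m"]
    have "integral {0..2*pi} (\<lambda>t. ?R (x m t) / (x m t - 0) * x m t) = 2 * pi * residue (\<lambda>z. ?R z / (z - 0)) 0"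
      using r(2) rpos unfolding x_def by simp
    also have "residue (\<lambda>z. ?R z / (z - 0)) 0 = ?R 0"
      by (intro residue_simple[OF _ _ Rh]) auto
    finally show ?thesis using xne by simp
  qed
  have iX: "integral {0..2*pi} (X m) = 2 * pi * (cnj (g w) - (\<Sum>j<N. f (a j) * residue_coeff b N w j))" for m
  proof -
    have "integral {0..2*pi} (X m) = integral {0..2*pi} (\<lambda>t. cnj (X1 m t)) - integral {0..2*pi} (X2 m)"
      unfolding X_def by (intro integral_diff integrable_continuous_interval continuous_intros c1 c2)
    then show ?thesis by (simp add: i1 i2 right_diff_distrib flip: integral_cnj)
  qed
  \<comment> \<open>\<open>E\<close> is affine in the real part, so averaging it over a circle
    amounts to evaluating it at the mean \<open>?R 0\<close>.\<close>
  have iE: "integral {0..2*pi} (\<lambda>t. E (?R (x m t))) = 2 * pi * E (?R 0)" for m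
  proof -
    have int: "(\<lambda>t. ?R (x m t)) integrable_on {0..2*pi}"
      by (rule integrable_continuous_interval[OF cmp[OF Rh]])
    have "((\<lambda>t. Re (?R (x m t))) has_integral 2 * pi * Re (?R 0)) {0..2*pi}"
      using has_integral_Re[OF integrable_integral[OF int]] by (simp add: i3)
    moreover have "((\<lambda>t. 1) has_integral 2 * pi) {0..2*pi}"
      using has_integral_const_real[of "1::real" 0 "2*pi"] by simp
    ultimately have "((\<lambda>t. A * (s / 2) * 1 + A / s * (1 - Re (?R (x m t)))) has_integral
        A * (s / 2) * (2 * pi) + A / s * (2 * pi - 2 * pi * Re (?R 0))) {0..2*pi}"
      by (intro has_integral_add has_integral_mult_right has_integral_diff)
    moreover have "A * (s / 2) * 1 + A / s * (1 - \<rho>) = A * (s / 2 + (1 - \<rho>) / s)" for \<rho>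
      by (simp add: distrib_left)
    moreover have "A * (s / 2) * (2 * pi) + A / s * (2 * pi - 2 * pi * Re (?R 0)) = 2 * pi * E (?R 0)"
    proof -
      have "A / s * (2 * pi - 2 * pi * c) = 2 * pi * (A * ((1 - c) / s))" for c
        using s by (simp add: field_simps)
      then show ?thesis by (simp add: E_def distrib_left)
    qed
    ultimately show ?thesis unfolding E_def by (intro integral_unique) (simp only:)
  qed

  have Epos: "0 \<le> E \<rho>" if "cmod \<rho> \<le> 1" for \<rho>
    using A0 s complex_Re_le_cmod[of \<rho>] that by (auto simp: E_def intro!: mult_nonneg_nonneg add_nonneg_nonneg)
  have Ybd: "\<bar>Y m t\<bar> \<le> G / (r0 - cmod w) + Fb / (\<delta> * (1 - cmod w))" for m t
  proof -
    have "cmod (X1 m t) \<le> G * 1 / (r0 - cmod w)"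
      unfolding X1_def norm_divide norm_mult
    proof (intro frac_le mult_mono)
      show "r0 - cmod w \<le> cmod (x m t - w)"
        using norm_triangle_ineq2[of "x m t" w] nx[of m t] r(1)[of m] by linarith
    qed (use G[OF xD] nx1 r0 G0 in auto)
    moreover have "cmod (X2 m t) \<le> Fb * 1 / (\<delta> * (1 - cmod w))"
      unfolding X2_def norm_divide norm_mult
    proof (intro frac_le mult_mono)
      show "\<delta> \<le> cmod (?P (x m t))" using \<delta>(2) nx r(1) nx1 by simp
      have "cmod w * cmod (x m t) \<le> cmod w" using nx1 by (intro mult_left_le) auto
      then show "1 - cmod w \<le> cmod (1 - cnj w * x m t)" using norm_one_minus_ge[of w "x m t"] by linarith
    qed (use Fb[OF xD] nx1 Fb0 \<delta>(1) w in auto)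
    moreover have "cmod (X m t) \<le> cmod (X1 m t) + cmod (X2 m t)"
      unfolding X_def using norm_triangle_ineq4[of "cnj (X1 m t)" "X2 m t"] by simp
    moreover have "0 \<le> E (?R (x m t))" using xD by (intro Epos R1) auto
    moreover have "\<bar>Y m t\<bar> \<le> cmod (X m t)"
      using \<open>0 \<le> E (?R (x m t))\<close> by (auto simp: Y_def)
    ultimately show ?thesis by simp
  qed

  have Ylim: "(\<lambda>m. Y m t) \<longlonglongrightarrow> 0"
    if f_lim: "has_boundary_value f (cis t) u" and B_lim: "has_boundary_value (blaschke_product b a) (cis t) v"
      and g_lim: "has_boundary_value g (cis t) y" and u: "u = v * cnj (cis t * y)" for t u v y
  proof -
    define \<zeta> where "\<zeta> = cis t"
    define \<rho> where "\<rho> = v / ?P \<zeta>"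
    have \<zeta>1: "cmod \<zeta> = 1" by (simp add: \<zeta>_def)
    have radial: "(\<lambda>m. h (x m t)) \<longlonglongrightarrow> l" if "has_boundary_value h (cis t) l" for h l
      using filterlim_compose[OF that[unfolded has_boundary_value_def] rlim] by (simp add: x_def)
    have xlim: "(\<lambda>m. x m t) \<longlonglongrightarrow> \<zeta>"
    proof -
      have "r \<longlonglongrightarrow> 1" using rlim by (simp add: filterlim_at)
      from tendsto_mult[OF tendsto_of_real[OF this, where 'a = complex] tendsto_const[of "cis t"]]
      show ?thesis by (simp add: x_def \<zeta>_def)
    qed
    have Plim: "(\<lambda>m. ?P (x m t)) \<longlonglongrightarrow> ?P \<zeta>"
      using continuous_on_tendsto_compose[OF Pc xlim] \<zeta>1 xcb by simp
    have P1: "cmod (?P \<zeta>) = 1" by (rule norm_partial_product_circle[OF b \<zeta>1])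
    \<comment> \<open>The tail product equals the full product over the partial one. The latter is
      continuous and unimodular on the circle, so the radial limit of the tail exists wherever that
      of the full product does.\<close>
    have "(\<lambda>m. blaschke_product b a (x m t) / ?P (x m t)) \<longlonglongrightarrow> \<rho>"
      unfolding \<rho>_def using P1 by (intro tendsto_divide radial[OF B_lim] Plim) auto
    moreover have "blaschke_product b a (x m t) / ?P (x m t) = ?R (x m t)" for m
      using blaschke_product_split[of "x m t" b N] xD Pne by simp
    ultimately have Rlim: "(\<lambda>m. ?R (x m t)) \<longlonglongrightarrow> \<rho>" by simp
    have \<rho>1: "cmod \<rho> \<le> 1"
      by (rule LIMSEQ_le_const2[OF tendsto_norm[OF Rlim]]) (use R1 xD in auto)
    have y: "cmod y \<le> G"
      by (rule LIMSEQ_le_const2[OF tendsto_norm[OF radial[OF g_lim]]]) (use G xD in auto)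
    have \<zeta>w: "\<zeta> - w \<noteq> 0" using \<zeta>1 w by auto
    have k0: "1 - cnj w * \<zeta> \<noteq> 0" using wne \<zeta>1 by simp
    have "(\<lambda>m. X m t) \<longlonglongrightarrow> cnj (y * \<zeta> / (\<zeta> - w)) - u * \<zeta> / (?P \<zeta> * (1 - cnj w * \<zeta>))"
      unfolding X_def X1_def X2_def using \<zeta>w k0 P1
      by (intro tendsto_intros radial[OF f_lim] radial[OF g_lim] xlim Plim) auto
    moreover have "cnj (y * \<zeta> / (\<zeta> - w)) - u * \<zeta> / (?P \<zeta> * (1 - cnj w * \<zeta>)) = cnj y * (1 - \<rho>) / (1 - cnj w * \<zeta>)"
    proof -
      have z: "\<zeta> * cnj \<zeta> = 1" using \<zeta>1 by (simp add: complex_norm_square[symmetric])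
      have "cnj \<zeta> * (1 - cnj w * \<zeta>) = cnj (\<zeta> - w)" using z by (simp add: algebra_simps)
      then have "cnj (y * \<zeta> / (\<zeta> - w)) = cnj y * cnj \<zeta> / (cnj \<zeta> * (1 - cnj w * \<zeta>))" by simp
      also have "\<dots> = cnj y / (1 - cnj w * \<zeta>)" using z by auto
      finally have 1: "cnj (y * \<zeta> / (\<zeta> - w)) = cnj y / (1 - cnj w * \<zeta>)" .
      have "u * \<zeta> = v * cnj y * (\<zeta> * cnj \<zeta>)" unfolding u \<zeta>_def by simp
      then have "u * \<zeta> = v * cnj y" using z by simp
      then have "u * \<zeta> / (?P \<zeta> * (1 - cnj w * \<zeta>)) = cnj y * \<rho> / (1 - cnj w * \<zeta>)" by (simp add: \<rho>_def)
      with 1 show ?thesis by (simp add: algebra_simps diff_divide_distrib)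
    qed
    ultimately have Xlim: "(\<lambda>m. X m t) \<longlonglongrightarrow> cnj y * (1 - \<rho>) / (1 - cnj w * \<zeta>)" by simp
    have Elim: "(\<lambda>m. E (?R (x m t))) \<longlonglongrightarrow> E \<rho>"
      unfolding E_def using s by (intro tendsto_intros Rlim) auto
    have "cmod (cnj y * (1 - \<rho>) / (1 - cnj w * \<zeta>)) \<le> G * cmod (1 - \<rho>) / (1 - cmod w)"
      unfolding norm_divide norm_mult
    proof (intro frac_le mult_mono)
      show "1 - cmod w \<le> cmod (1 - cnj w * \<zeta>)" using norm_one_minus_ge[of w \<zeta>] \<zeta>1 by simp
    qed (use y G0 w in auto)
    also have "\<dots> = A * cmod (1 - \<rho>)" by (simp add: A_def)
    also have "\<dots> \<le> E \<rho>" unfolding E_def by (intro mult_left_mono dist_one_le_Re \<rho>1 s A0)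
    finally have le: "cmod (cnj y * (1 - \<rho>) / (1 - cnj w * \<zeta>)) \<le> E \<rho>" .
    have "(\<lambda>m. Y m t) \<longlonglongrightarrow> max 0 (cmod (cnj y * (1 - \<rho>) / (1 - cnj w * \<zeta>)) - E \<rho>)"
      unfolding Y_def by (intro tendsto_intros Xlim Elim)
    then show ?thesis using le by (simp add: max_absorb1)
  qed
  have "AE t\<in>{0..2*pi} in lborel. (\<lambda>m. Y m t) \<longlonglongrightarrow> 0"
    using ae by eventually_elim (use Ylim in blast)
  from integral_tendsto_0[OF cY Ybd this]
  have Y0: "(\<lambda>m. integral {0..2*pi} (Y m)) \<longlonglongrightarrow> 0" .

  let ?D = "cnj (g w) - (\<Sum>j<N. f (a j) * residue_coeff b N w j)"
  have "2 * pi * cmod ?D \<le> 2 * pi * E (?R 0) + integral {0..2*pi} (Y m)" for m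
  proof -
    \<comment> \<open>The left side does not depend on \<open>m\<close>. Pointwise \<open>X\<close>
      is at most \<open>E\<close> plus the excess \<open>Y\<close>, and the integral of
      \<open>Y\<close> vanishes in the limit.\<close>
    have "2 * pi * cmod ?D = cmod (integral {0..2*pi} (X m))" unfolding iX norm_mult by simp
    also have "\<dots> \<le> integral {0..2*pi} (\<lambda>t. E (?R (x m t)) + Y m t)"
    proof (rule integral_norm_bound_integral)
      show "X m integrable_on {0..2*pi}" by (rule integrable_continuous_interval[OF cX])
      show "(\<lambda>t. E (?R (x m t)) + Y m t) integrable_on {0..2*pi}"
        by (intro integrable_continuous_interval continuous_intros cE cY)
    qed (auto simp: Y_def)
    also have "\<dots> = 2 * pi * E (?R 0) + integral {0..2*pi} (Y m)"
      unfolding iE[of m, symmetric] by (intro integral_add integrable_continuous_interval cE cY)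
    finally show ?thesis .
  qed
  then have "2 * pi * cmod ?D \<le> 2 * pi * E (?R 0) + 0"
    by (intro LIMSEQ_le_const[OF tendsto_add[OF tendsto_const Y0]]) auto
  then have "cmod ?D \<le> E (?R 0)" by simp
  then show ?thesis by (simp only: E_def A_def)
qed

end

section \<open>The uniform Frostman condition\<close>

text \<open>
  Gliding hump: the blocks \<open>{n k..<n (Suc k)}\<close> are chosen so that the \<open>k\<close>-th functional has nearly all
  of its mass on the \<open>k\<close>-th block, where \<open>\<alpha>\<close> aligns the phases.
\<close>

lemma finite_support_uniform_bound:
  fixes c :: "'i \<Rightarrow> nat \<Rightarrow> complex" and N :: "'i \<Rightarrow> nat"
  assumes bd: "\<And>\<alpha>. (\<And>j. cmod (\<alpha> j) \<le> 1) \<Longrightarrow> \<exists>M. \<forall>i\<in>I. cmod (\<Sum>j<N i. \<alpha> j * c i j) \<le> M"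
  shows "\<exists>M. \<forall>i\<in>I. (\<Sum>j<N i. cmod (c i j)) \<le> M"
proof (rule ccontr)
  assume contra: "\<nexists>M. \<forall>i\<in>I. (\<Sum>j<N i. cmod (c i j)) \<le> M"
  \<comment> \<open>Testing with the j-th unit vector bounds the j-th coefficient uniformly over all
    functionals.\<close>
  have "\<exists>C\<ge>0. \<forall>i\<in>I. j < N i \<longrightarrow> cmod (c i j) \<le> C" for j
  proof -
    have "\<exists>M. \<forall>i\<in>I. cmod (\<Sum>l<N i. (if l = j then 1 else 0) * c i l) \<le> M"
      by (rule bd) auto
    then obtain M where M: "\<And>i. i \<in> I \<Longrightarrow> cmod (\<Sum>l<N i. (if l = j then 1 else 0) * c i l) \<le> M"
      by blast
    have "cmod (c i j) \<le> max M 0" if "i \<in> I" "j < N i" for i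
    proof -
      have "(\<Sum>l<N i. (if l = j then 1 else 0) * c i l) = (\<Sum>l<N i. if l = j then c i l else 0)"
        by (intro sum.cong) auto
      also have "\<dots> = c i j" using that by (simp add: sum.delta)
      finally show ?thesis using M[OF that(1)] by simp
    qed
    then show ?thesis by (intro exI[of _ "max M 0"]) auto
  qed
  then obtain C where C0: "\<And>j. 0 \<le> C j" and C: "\<And>i j. i \<in> I \<Longrightarrow> j < N i \<Longrightarrow> cmod (c i j) \<le> C j"
    by metis
  \<comment> \<open>One copy of the sum of \<open>C\<close> pays for the mass before index
    \<open>n\<close>, the other for what that initial part can cancel in the pairing;
    \<open>k\<close> is left over.\<close>
  have "\<exists>i\<in>I. (\<Sum>j<N i. cmod (c i j)) > 2 * (\<Sum>j<n. C j) + real k" for n k :: nat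
    using contra by (meson not_le)
  then obtain pick where pick: "\<And>n k. pick n k \<in> I"
    "\<And>n k. (\<Sum>j<N (pick n k). cmod (c (pick n k) j)) > 2 * (\<Sum>j<n. C j) + real k"
    by metis
  \<comment> \<open>Each block ends where the support of the functional chosen at its start ends, so
    nothing remains beyond the block.\<close>
  define n where "n = rec_nat 0 (\<lambda>k m. N (pick m k))"
  define ix where "ix k = pick (n k) k" for k
  have nSuc: "n (Suc k) = N (ix k)" for k by (simp add: n_def ix_def)
  have low: "(\<Sum>j<m. cmod (c (ix k) j)) \<le> (\<Sum>j<m. C j)" if "m \<le> N (ix k)" for m k
    using that pick(1) by (intro sum_mono C) (auto simp: ix_def)
  \<comment> \<open>A support ending by \<open>n k\<close> would have mass at most the sum of
    \<open>C\<close>, against the choice of the functional.\<close>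
  have nlt: "n k < n (Suc k)" for k
  proof (rule ccontr)
    assume "\<not> n k < n (Suc k)"
    then have le: "N (ix k) \<le> n k" by (simp add: nSuc)
    have "(\<Sum>j<N (ix k). cmod (c (ix k) j)) \<le> (\<Sum>j<N (ix k). C j)" by (rule low) simp
    also have "\<dots> \<le> (\<Sum>j<n k. C j)" using le C0 by (intro sum_mono2) auto
    also have "\<dots> \<le> 2 * (\<Sum>j<n k. C j)" using sum_nonneg[of "{..<n k}" C] C0 by simp
    finally show False using pick(2)[of "n k" k] by (simp add: ix_def)
  qed
  have mono: "strict_mono n" using nlt by (simp add: strict_mono_Suc_iff)
  \<comment> \<open>The \<open>LEAST\<close> term is the index of the block that contains
    \<open>j\<close>.\<close>
  define \<alpha> where "\<alpha> = (\<lambda>j. cnj (sgn (c (ix (LEAST k. j < n (Suc k))) j)))"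
  have \<alpha>1: "cmod (\<alpha> j) \<le> 1" for j by (simp add: \<alpha>_def norm_sgn)
  have \<alpha>: "\<alpha> j * c (ix k) j = of_real (cmod (c (ix k) j))" if "n k \<le> j" "j < n (Suc k)" for j k
  proof -
    have "(LEAST l. j < n (Suc l)) = k"
    proof (rule Least_equality)
      fix l assume "j < n (Suc l)"
      then have "n k < n (Suc l)" using that by simp
      then show "k \<le> l" using strict_mono_less[OF mono] by simp
    qed (rule that)
    moreover have "cnj (sgn d) * d = of_real (cmod d)" for d :: complex
    proof (cases "d = 0")
      case False
      have "cnj (sgn d) * d = d * cnj d / of_real (cmod d)" by (simp add: sgn_eq)
      also have "\<dots> = of_real (cmod d)"
        using False by (simp only: complex_norm_square[symmetric]) (simp add: power2_eq_square)
      finally show ?thesis .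
    qed simp
    ultimately show ?thesis by (simp add: \<alpha>_def)
  qed
  obtain M where M: "\<And>i. i \<in> I \<Longrightarrow> cmod (\<Sum>j<N i. \<alpha> j * c i j) \<le> M" using bd[of \<alpha>, OF \<alpha>1] by blast
  obtain k :: nat where k: "M < real k" using reals_Archimedean2 by blast
  define i where "i = ix k"
  have nk: "n k \<le> N i" using nlt[of k] by (simp add: nSuc i_def)
  have split: "(\<Sum>j<N i. h j) = (\<Sum>j<n k. h j) + (\<Sum>j\<in>{n k..<N i}. h j)" for h :: "nat \<Rightarrow> 'b::comm_monoid_add"
    using nk by (metis sum.atLeastLessThan_concat lessThan_atLeast0 zero_le)
  have "(\<Sum>j\<in>{n k..<N i}. \<alpha> j * c i j) = of_real (\<Sum>j\<in>{n k..<N i}. cmod (c i j))"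
    unfolding of_real_sum by (intro sum.cong refl) (simp add: \<alpha> nSuc i_def)
  then have 1: "cmod (\<Sum>j\<in>{n k..<N i}. \<alpha> j * c i j) = (\<Sum>j\<in>{n k..<N i}. cmod (c i j))"
    by (simp only: norm_of_real) (simp add: sum_nonneg)
  have "cmod (\<Sum>j<n k. \<alpha> j * c i j) \<le> (\<Sum>j<n k. cmod (c i j))"
    using \<alpha>1 by (intro sum_norm_le) (simp add: norm_mult mult_left_le_one_le)
  moreover have "(\<Sum>j<n k. cmod (c i j)) \<le> (\<Sum>j<n k. C j)" using low nk by (simp add: i_def)
  moreover have "(\<Sum>j<N i. cmod (c i j)) > 2 * (\<Sum>j<n k. C j) + real k"
    using pick(2)[of "n k" k] by (simp add: i_def ix_def)
  moreover have "cmod (\<Sum>j<N i. \<alpha> j * c i j) \<ge> cmod (\<Sum>j\<in>{n k..<N i}. \<alpha> j * c i j) - cmod (\<Sum>j<n k. \<alpha> j * c i j)"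
    unfolding split by (metis add.commute norm_diff_ineq)
  moreover have "cmod (\<Sum>j<N i. \<alpha> j * c i j) \<le> M" using M pick(1) by (simp add: i_def ix_def)
  ultimately show False using k 1 split[of "\<lambda>j. cmod (c i j)"] by linarith
qed

text \<open>
  The usual condition takes the supremum over \<open>w\<close> on the circle; by continuity of the finite sums
  the supremum over the open disc is equivalent.
\<close>

definition frostman :: "(nat \<Rightarrow> complex) \<Rightarrow> bool" where
  "frostman a \<longleftrightarrow> (\<exists>M. \<forall>w N. cmod w < 1 \<longrightarrow>
     (\<Sum>j<N. (1 - (cmod (a j))\<^sup>2) / cmod (1 - cnj w * a j)) \<le> M)"

lemma (in blaschke_sequence) interpolating_imp_frostman:
  assumes inj: "inj a" and b: "cmod b = 1" and int: "interpolating a (K_inf (blaschke_product b a))"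
  shows "frostman a"
proof -
  \<comment> \<open>Pairs for which the factor of \<open>G\<close> in
    \<open>pairing_estimate\<close> is at most 1 for some \<open>s\<close>. For them the functional
    differs from \<open>cnj (g w)\<close> by at most \<open>G\<close>, hence is bounded by
    \<open>2 * G\<close> whatever the pair.\<close>
  define I where "I = {(N, w). cmod w < 1 \<and> 
     (\<exists>s>0. 1 / (1 - cmod w) * (s / 2 + (1 - Re (subproduct a {N..} 0)) / s) \<le> 1)}"
  have "\<exists>M. \<forall>i\<in>I. (\<Sum>j<fst i. cmod (residue_coeff b (fst i) (snd i) j)) \<le> M"
  proof (rule finite_support_uniform_bound)
    fix \<alpha> :: "nat \<Rightarrow> complex" assume "\<And>j. cmod (\<alpha> j) \<le> 1"
    then have "bounded (range \<alpha>)" by (auto simp: bounded_iff)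
    then obtain f where f: "f \<in> K_inf (blaschke_product b a)" "\<And>j. f (a j) = \<alpha> j"
      using int unfolding interpolating_def by blast
    from f(1) obtain g where fH: "f \<in> H_inf" and g: "g \<in> H_inf" and
      ae: "AE t\<in>{0..2*pi} in lborel. \<exists>u v y. has_boundary_value f (cis t) u \<and>
         has_boundary_value (blaschke_product b a) (cis t) v \<and>
         has_boundary_value g (cis t) y \<and> u = v * cnj (cis t * y)"
      unfolding K_inf_def by blast
    obtain G where G: "\<And>z. z \<in> unit_disc \<Longrightarrow> cmod (g z) \<le> G"
      using g unfolding H_inf_def bounded_iff by blast
    have G0: "0 \<le> G" using order_trans[OF norm_ge_zero G[of 0]] by simp
    have "cmod (\<Sum>j<N. \<alpha> j * residue_coeff b N w j) \<le> 2 * G" if Nw: "(N, w) \<in> I" for N w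
    proof -
      obtain s where w: "cmod w < 1" and s: "s > 0"
        "1 / (1 - cmod w) * (s / 2 + (1 - Re (subproduct a {N..} 0)) / s) \<le> 1"
        using Nw by (auto simp: I_def)
      have "cmod (cnj (g w) - (\<Sum>j<N. \<alpha> j * residue_coeff b N w j))
          \<le> G * (1 / (1 - cmod w) * (s / 2 + (1 - Re (subproduct a {N..} 0)) / s))"
        using pairing_estimate[OF inj b fH g ae G w s(1), of N] f(2) by simp
      also have "\<dots> \<le> G * 1" by (intro mult_left_mono s G0)
      finally have "cmod (cnj (g w) - (\<Sum>j<N. \<alpha> j * residue_coeff b N w j)) \<le> G" by simp
      moreover have "cmod (cnj (g w)) \<le> G" using G[of w] w by simp
      ultimately show ?thesis
        using norm_triangle_sub[of "\<Sum>j<N. \<alpha> j * residue_coeff b N w j" "cnj (g w)"]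
        by (simp add: norm_minus_commute)
    qed
    then show "\<exists>M. \<forall>i\<in>I. cmod (\<Sum>j<fst i. \<alpha> j * residue_coeff b (fst i) (snd i) j) \<le> M"
      by (intro exI[of _ "2 * G"]) auto
  qed
  then obtain M where M: "\<And>N w. (N, w) \<in> I \<Longrightarrow> (\<Sum>j<N. cmod (residue_coeff b N w j)) \<le> M"
    by fastforce
  have "(\<Sum>j<N. (1 - (cmod (a j))\<^sup>2) / cmod (1 - cnj w * a j)) \<le> M" if w: "cmod w < 1" for w N
  proof -
    \<comment> \<open>With this \<open>s\<close> the first term of the error contributes one half; a
      tail value within \<open>s\<^sup>2 / 2\<close> of 1 makes the second contribute at most one
      half.\<close>
    define s where "s = 1 - cmod w"
    have s: "0 < s" using w by (simp add: s_def)
    have "(\<lambda>N. Re (subproduct a {N..} 0)) \<longlonglongrightarrow> 1"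
      using tendsto_Re[OF subproduct_tail_at_0] by simp
    moreover have "1 - s\<^sup>2 / 2 < 1" using s by simp
    ultimately have "\<forall>\<^sub>F N in sequentially. 1 - s\<^sup>2 / 2 < Re (subproduct a {N..} 0)"
      by (rule order_tendstoD(1))
    then obtain N0 where N0: "\<And>n. n \<ge> N0 \<Longrightarrow> 1 - s\<^sup>2 / 2 < Re (subproduct a {n..} 0)"
      by (auto simp: eventually_sequentially)
    \<comment> \<open>The summands are nonnegative, so \<open>N\<close> may be enlarged until the
      pair lies in \<open>I\<close>.\<close>
    define K where "K = max N N0"
    have "1 - Re (subproduct a {K..} 0) \<le> s\<^sup>2 / 2" using N0[of K] by (simp add: K_def)
    then have "1 / s * (s / 2 + (1 - Re (subproduct a {K..} 0)) / s) \<le> 1 / s * (s / 2 + (s\<^sup>2 / 2) / s)"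
      using s by (intro mult_left_mono add_left_mono divide_right_mono) auto
    also have "\<dots> = 1" using s by (simp add: field_simps power2_eq_square)
    finally have KI: "(K, w) \<in> I"
      unfolding I_def using w s by (auto simp only: s_def mem_Collect_eq case_prod_conv)
    have sq: "(cmod (a j))\<^sup>2 \<le> 1" for j using in_disc[of j] by (simp add: power_le_one less_imp_le)
    have "(\<Sum>j<N. (1 - (cmod (a j))\<^sup>2) / cmod (1 - cnj w * a j)) \<le> (\<Sum>j<K. (1 - (cmod (a j))\<^sup>2) / cmod (1 - cnj w * a j))"
      using sq by (intro sum_mono2) (auto simp: K_def)
    also have "\<dots> \<le> (\<Sum>j<K. cmod (residue_coeff b K w j))"
      by (intro sum_mono norm_residue_coeff_ge b inj w)
    also have "\<dots> \<le> M" by (rule M[OF KI])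
    finally show ?thesis .
  qed
  then show ?thesis by (auto simp: frostman_def)
qed

section \<open>Stability of the Frostman condition under perturbation\<close>

lemma frostman_perturb:
  assumes a: "\<And>j. cmod (a j) < 1" and z: "\<And>j. cmod (z j) < 1"
    and \<rho>: "\<And>j. pseudohyp (a j) (z j) \<le> \<mu>" "\<mu> < 1" and F: "frostman a"
  shows "frostman z"
proof -
  have term_le: "(1 - (cmod v)\<^sup>2) / cmod (1 - cnj w * v) \<le> (1 - (cmod u)\<^sup>2) / cmod (1 - cnj w * u) / (1 - \<mu>)\<^sup>2"
    if u: "cmod u < 1" and v: "cmod v < 1" and w: "cmod w < 1" and le: "pseudohyp u v \<le> \<mu>" for u v w
  proof -
    \<comment> \<open>In this coordinate \<open>v\<close> is
      \<open>(u + \<tau>) / (1 + cnj u * \<tau>)\<close> with \<open>\<tau>\<close> of modulus at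
      most \<open>\<mu>\<close>. The identities \<open>one\<close> and \<open>two\<close> express
      the two denominators through \<open>\<tau>\<close>.\<close>
    define \<tau> where "\<tau> = (v - u) / (1 - cnj u * v)"
    have D: "1 - cnj u * v \<noteq> 0" using one_minus_cnj_mult_nz[of u v] u v by simp
    have wu: "1 - cnj w * u \<noteq> 0" using one_minus_cnj_mult_nz[of w u] u w by simp
    have wv: "1 - cnj w * v \<noteq> 0" using one_minus_cnj_mult_nz[of w v] v w by simp
    have \<tau>: "cmod \<tau> \<le> \<mu>" using le by (simp add: pseudohyp_def \<tau>_def)
    have \<mu>0: "0 \<le> \<mu>" using \<tau> norm_ge_zero order_trans by blast
    have \<tau>D: "\<tau> * (1 - cnj u * v) = v - u" using D by (simp add: \<tau>_def)
    have one: "(1 + cnj u * \<tau>) * (1 - cnj u * v) = of_real (1 - (cmod u)\<^sup>2)"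
    proof -
      have "(1 + cnj u * \<tau>) * (1 - cnj u * v) = 1 - cnj u * v + cnj u * (v - u)"
        by (simp add: distrib_right mult.assoc \<tau>D)
      also have "\<dots> = 1 - u * cnj u" by (simp add: algebra_simps)
      finally show ?thesis by (simp only: complex_norm_square of_real_diff of_real_1)
    qed
    have two: "(1 + cnj u * \<tau>) * (1 - cnj w * v) = (1 - cnj w * u) + \<tau> * cnj (u - w)"
      using \<tau>D by (simp add: algebra_simps) algebra
    have su: "(cmod u)\<^sup>2 < 1" using u by (simp add: power_less_one_iff abs_square_less_1)
    have sv: "(cmod v)\<^sup>2 < 1" using v by (simp add: power_less_one_iff abs_square_less_1)
    have n1: "cmod (1 + cnj u * \<tau>) * cmod (1 - cnj u * v) = 1 - (cmod u)\<^sup>2"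
      unfolding norm_mult[symmetric] one using su by (simp only: norm_of_real)
    have idv: "(1 - (cmod v)\<^sup>2) * (1 - (cmod u)\<^sup>2) = (cmod (1 - cnj u * v))\<^sup>2 * (1 - (cmod \<tau>)\<^sup>2)"
    proof -
      have "(cmod (v - u))\<^sup>2 = (cmod \<tau>)\<^sup>2 * (cmod (1 - cnj u * v))\<^sup>2"
        unfolding \<tau>D[symmetric] norm_mult power_mult_distrib ..
      then show ?thesis using moebius_identity[of u v] by (simp add: algebra_simps)
    qed
    \<comment> \<open>The pseudohyperbolic distance of \<open>u\<close> and \<open>w\<close> is at
      most 1, so the \<open>\<tau>\<close> term in \<open>two\<close> is at most
      \<open>\<mu>\<close> times the main term.\<close>
    have "cmod (u - w) \<le> cmod (1 - cnj w * u)"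
    proof (rule power2_le_imp_le)
      have "0 \<le> (1 - (cmod w)\<^sup>2) * (1 - (cmod u)\<^sup>2)" using u w by (intro mult_nonneg_nonneg) (auto simp: power_le_one)
      then show "(cmod (u - w))\<^sup>2 \<le> (cmod (1 - cnj w * u))\<^sup>2" using moebius_identity[of w u] by linarith
    qed simp
    then have "cmod (\<tau> * cnj (u - w)) \<le> \<mu> * cmod (1 - cnj w * u)"
      unfolding norm_mult complex_mod_cnj using \<tau> \<mu>0 by (intro mult_mono) auto
    moreover have "cmod (1 - cnj w * u) - cmod (\<tau> * cnj (u - w)) \<le> cmod ((1 - cnj w * u) + \<tau> * cnj (u - w))"
      using norm_diff_ineq by blast
    ultimately have n2: "(1 - \<mu>) * cmod (1 - cnj w * u) \<le> cmod (1 + cnj u * \<tau>) * cmod (1 - cnj w * v)"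
      unfolding norm_mult[symmetric] two by (simp add: algebra_simps)
    have n3: "1 - \<mu> \<le> cmod (1 + cnj u * \<tau>)"
    proof -
      have "cmod (cnj u * \<tau>) \<le> 1 * \<mu>" unfolding norm_mult using u \<tau> \<mu>0 by (intro mult_mono) auto
      then show ?thesis using norm_diff_ineq[of 1 "cnj u * \<tau>"] by simp
    qed
    define p q x y where "p = cmod (1 + cnj u * \<tau>)" and "q = cmod (1 - cnj u * v)"
      and "x = cmod (1 - cnj w * u)" and "y = cmod (1 - cnj w * v)"
    have pos: "0 < q" "0 < x" "0 < y" "0 < p" "0 < 1 - \<mu>" using D wu wv \<rho>(2) n3 by (auto simp: p_def q_def x_def y_def)
    have "(1 - (cmod v)\<^sup>2) * (p * q) = q\<^sup>2 * (1 - (cmod \<tau>)\<^sup>2)"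
      using idv n1 by (simp only: p_def q_def)
    also have "\<dots> \<le> q\<^sup>2 * 1" by (intro mult_left_mono) auto
    finally have "(1 - (cmod v)\<^sup>2) * (p * q) \<le> q\<^sup>2 * 1" .
    then have "(1 - (cmod v)\<^sup>2) * p \<le> q"
      using mult_le_cancel_right_pos[OF pos(1), of "(1 - (cmod v)\<^sup>2) * p" q]
      by (simp add: power2_eq_square mult.assoc)
    moreover have "(1 - \<mu>) * q \<le> p * q" using n3 pos by (simp add: p_def)
    ultimately have "(1 - \<mu>) * ((1 - (cmod v)\<^sup>2) * p) \<le> 1 - (cmod u)\<^sup>2"
      using n1[folded p_def q_def] mult_left_mono[of "(1 - (cmod v)\<^sup>2) * p" q "1 - \<mu>"] pos by linarith
    then have A: "(1 - (cmod v)\<^sup>2) * p * (1 - \<mu>) \<le> 1 - (cmod u)\<^sup>2" by (simp add: mult_ac)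
    \<comment> \<open>Numerator and denominator each lose one factor \<open>1 - \<mu>\<close>, and
      the common factor \<open>p\<close> cancels.\<close>
    have "(1 - (cmod v)\<^sup>2) * p * (1 - \<mu>) * ((1 - \<mu>) * x) \<le> (1 - (cmod u)\<^sup>2) * (p * y)"
      by (intro mult_mono A n2[folded p_def x_def y_def]) (use pos su in auto)
    then have "(1 - (cmod v)\<^sup>2) * ((1 - \<mu>)\<^sup>2 * x) * p \<le> (1 - (cmod u)\<^sup>2) * y * p"
      by (simp only: power2_eq_square mult_ac)
    then have "(1 - (cmod v)\<^sup>2) * ((1 - \<mu>)\<^sup>2 * x) \<le> (1 - (cmod u)\<^sup>2) * y"
      using pos mult_le_cancel_right_pos by blast
    then have "(1 - (cmod v)\<^sup>2) / y \<le> (1 - (cmod u)\<^sup>2) / (x * (1 - \<mu>)\<^sup>2)"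
      using pos by (simp add: divide_simps mult_ac)
    then show ?thesis by (simp add: x_def y_def)
  qed
  obtain M where M: "\<And>w N. cmod w < 1 \<Longrightarrow> (\<Sum>j<N. (1 - (cmod (a j))\<^sup>2) / cmod (1 - cnj w * a j)) \<le> M"
    using F unfolding frostman_def by blast
  have "(\<Sum>j<N. (1 - (cmod (z j))\<^sup>2) / cmod (1 - cnj w * z j)) \<le> M / (1 - \<mu>)\<^sup>2" if w: "cmod w < 1" for w N
  proof -
    have "(\<Sum>j<N. (1 - (cmod (z j))\<^sup>2) / cmod (1 - cnj w * z j))
        \<le> (\<Sum>j<N. (1 - (cmod (a j))\<^sup>2) / cmod (1 - cnj w * a j) / (1 - \<mu>)\<^sup>2)"
      by (intro sum_mono term_le a z w \<rho>)
    also have "\<dots> \<le> M / (1 - \<mu>)\<^sup>2"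
      unfolding sum_divide_distrib[symmetric] by (intro divide_right_mono M w) auto
    finally show ?thesis .
  qed
  then show ?thesis unfolding frostman_def by blast
qed

section \<open>Interpolation under the Frostman condition\<close>

text \<open>Reduces radial limits to continuity on a closed radius, which uniform limits
  preserve.\<close>

lemma has_boundary_value_continuous:
  assumes "continuous_on ((\<lambda>r. of_real r * \<zeta>) ` {0..1}) F"
  shows "has_boundary_value F \<zeta> (F \<zeta>)"
proof -
  have "continuous_on {0..1::real} (\<lambda>r. F (of_real r * \<zeta>))"
    by (rule continuous_on_compose2[OF assms]) (auto intro!: continuous_intros)
  then have "((\<lambda>r. F (of_real r * \<zeta>)) \<longlongrightarrow> F (of_real 1 * \<zeta>)) (at 1 within {0..1::real})"
    unfolding continuous_on_def by (rule bspec) simp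
  then show ?thesis by (simp add: has_boundary_value_def at_within_Icc_at_left)
qed

text \<open>Passing from \<open>r * \<zeta>\<close> to \<open>\<zeta>\<close> changes the expression
  by at most \<open>1 - r\<close>, which is itself at most its modulus at
  \<open>r * \<zeta>\<close>. Bounds at a point of the circle thus control the whole radius.\<close>

lemma norm_one_minus_radial:
  assumes "cmod a < 1" "cmod \<zeta> = 1" "0 \<le> r" "r \<le> 1"
  shows "cmod (1 - cnj a * \<zeta>) \<le> 2 * cmod (1 - cnj a * (of_real r * \<zeta>))"
proof -
  have "cmod (1 - cnj a * \<zeta>) = cmod (1 - cnj a * (of_real r * \<zeta>) - of_real (1 - r) * (cnj a * \<zeta>))"
    by (simp add: algebra_simps)
  also have "\<dots> \<le> cmod (1 - cnj a * (of_real r * \<zeta>)) + cmod (of_real (1 - r) * (cnj a * \<zeta>))"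
    by (rule norm_triangle_ineq4)
  also have "cmod (of_real (1 - r) * (cnj a * \<zeta>)) = (1 - r) * cmod a"
    using assms by (simp add: norm_mult del: of_real_diff)
  also have "(1 - r) * cmod a \<le> 1 - r" using assms by (intro mult_left_le) auto
  also have "1 - r \<le> cmod (1 - cnj a * (of_real r * \<zeta>))"
  proof -
    have "cmod a * r \<le> 1 * r" using assms by (intro mult_right_mono) auto
    then show ?thesis using norm_one_minus_ge[of a "of_real r * \<zeta>"] assms by (simp add: norm_mult)
  qed
  finally show ?thesis by simp
qed

lemma (in disc_sequence) one_minus_le_sq: "0 \<le> 1 - cmod (a j)" "1 - cmod (a j) \<le> 1 - (cmod (a j))\<^sup>2"
  "1 - (cmod (a j))\<^sup>2 \<le> 2 * (1 - cmod (a j))"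
proof -
  show "0 \<le> 1 - cmod (a j)" using in_disc[of j] by simp
  have "(cmod (a j))\<^sup>2 \<le> cmod (a j)" using in_disc[of j] by (simp add: power2_eq_square mult_left_le)
  then show "1 - cmod (a j) \<le> 1 - (cmod (a j))\<^sup>2" by simp
  have "0 \<le> (1 - cmod (a j))\<^sup>2" by simp
  then show "1 - (cmod (a j))\<^sup>2 \<le> 2 * (1 - cmod (a j))" by (simp add: power2_eq_square algebra_simps)
qed

section \<open>Kernel series under a Frostman bound\<close>

locale frostman_sequence = blaschke_sequence +
  fixes M :: real
  assumes frostman_bound: "cmod w < 1 \<Longrightarrow> (\<Sum>j<N. (1 - (cmod (a j))\<^sup>2) / cmod (1 - cnj w * a j)) \<le> M"
begin

text \<open>The Szego kernel scaled to be 1 at \<open>a j\<close>; its modulus is the summand of the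
  Frostman condition.\<close>

definition kern :: "nat \<Rightarrow> complex \<Rightarrow> complex" where
  "kern j z = of_real (1 - (cmod (a j))\<^sup>2) / (1 - cnj (a j) * z)"

lemma norm_kern: "cmod (kern j z) = (1 - (cmod (a j))\<^sup>2) / cmod (1 - cnj (a j) * z)"
  using one_minus_le_sq[of j] by (simp add: kern_def norm_divide del: of_real_diff)

lemma holomorphic_kern: "kern j holomorphic_on cball 0 1"
  unfolding kern_def[abs_def] using one_minus_cnj_mult_nz[OF in_disc]
  by (intro holomorphic_intros) auto

text \<open>Finite kernel sums are continuous on the closed disc, so the bound extends to the
  circle.\<close>

lemma kern_partial_sum:
  assumes "cmod z \<le> 1"
  shows "(\<Sum>j<N. cmod (kern j z)) \<le> M"
proof (rule continuous_le_on_closure[of "ball 0 1" "\<lambda>z. \<Sum>j<N. cmod (kern j z)"])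
  show "continuous_on (closure (ball 0 1)) (\<lambda>z. \<Sum>j<N. cmod (kern j z))"
    using holomorphic_on_imp_continuous_on[OF holomorphic_kern] by (intro continuous_intros) auto
  show "z \<in> closure (ball 0 1)" using assms by simp
  show "(\<Sum>j<N. cmod (kern j x)) \<le> M" if "x \<in> ball 0 1" for x
    using frostman_bound[of x N] that by (simp add: norm_kern norm_cnj_swap[of _ x])
qed

lemma summable_kern: "cmod z \<le> 1 \<Longrightarrow> summable (\<lambda>j. cmod (kern j z))"
  by (rule summableI_nonneg_bounded[OF norm_ge_zero kern_partial_sum])

lemma suminf_kern: "cmod z \<le> 1 \<Longrightarrow> (\<Sum>j. cmod (kern j z)) \<le> M"
  by (rule suminf_le_const[OF summable_kern kern_partial_sum])

lemma regular_in_cball: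
  assumes "cmod z \<le> 1"
  shows "regular_at z"
  unfolding regular_at_def
proof (intro conjI assms summable_comparison_test'[OF summable_kern[OF assms], of 0])
  show "norm ((1 - cmod (a j)) / cmod (1 - cnj (a j) * z)) \<le> cmod (kern j z)" for j
    using one_minus_le_sq[of j] by (simp add: norm_kern divide_right_mono)
qed

lemma norm_kern_radial:
  assumes "cmod \<zeta> = 1" "z \<in> (\<lambda>r. of_real r * \<zeta>) ` {0..1}"
  shows "cmod (kern j z) \<le> 2 * cmod (kern j \<zeta>)"
proof -
  obtain r where r: "z = of_real r * \<zeta>" "0 \<le> r" "r \<le> 1" using assms(2) by fastforce
  have "cmod z \<le> 1" using r assms(1) by (simp add: norm_mult)
  then have "0 < cmod (1 - cnj (a j) * z)" "0 < cmod (1 - cnj (a j) * \<zeta>)"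
    using one_minus_cnj_mult_nz[OF in_disc] assms(1) by auto
  moreover have "cmod (1 - cnj (a j) * \<zeta>) \<le> 2 * cmod (1 - cnj (a j) * z)"
    unfolding r(1) by (rule norm_one_minus_radial[OF in_disc assms(1) r(2,3)])
  ultimately have "1 / cmod (1 - cnj (a j) * z) \<le> 2 / cmod (1 - cnj (a j) * \<zeta>)"
    by (simp add: divide_simps)
  moreover have "0 \<le> 1 - (cmod (a j))\<^sup>2" using one_minus_le_sq[of j] by linarith
  ultimately have "(1 - (cmod (a j))\<^sup>2) * (1 / cmod (1 - cnj (a j) * z))
      \<le> (1 - (cmod (a j))\<^sup>2) * (2 / cmod (1 - cnj (a j) * \<zeta>))"
    by (rule mult_left_mono)
  then show ?thesis
    by (simp add: norm_kern mult.commute)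
qed

lemma radial_in_cball:
  assumes "cmod \<zeta> = 1"
  shows "(\<lambda>r. of_real r * \<zeta>) ` {0..1} \<subseteq> cball 0 1"
  using assms by (auto simp: norm_mult)

text \<open>Along the radius the terms are at most twice their summable values at
  \<open>\<zeta>\<close>, so the convergence is uniform there and the radial limit exists at every
  point of the circle.\<close>

lemma continuous_on_radial_subproduct:
  assumes \<zeta>: "cmod \<zeta> = 1"
  shows "continuous_on ((\<lambda>r. of_real r * \<zeta>) ` {0..1}) (subproduct a S)"
proof (rule uniform_limit_theorem[OF always_eventually, rule_format])
  let ?X = "(\<lambda>r. of_real r * \<zeta>) ` {0..1}"
  show "uniform_limit ?X (\<lambda>n z. \<Prod>j<n. if j \<in> S then blaschke_factor (a j) z else 1) (subproduct a S) sequentially"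
  proof (rule uniform_limit_subproduct[where m = "\<lambda>j. 2 * cmod (kern j \<zeta>)"])
    fix j z assume z: "z \<in> ?X"
    have "(1 - cmod (a j)) / cmod (1 - cnj (a j) * z) \<le> cmod (kern j z)"
      using one_minus_le_sq[of j] by (simp add: norm_kern divide_right_mono)
    also have "\<dots> \<le> 2 * cmod (kern j \<zeta>)" by (rule norm_kern_radial[OF \<zeta> z])
    finally show "(1 - cmod (a j)) / cmod (1 - cnj (a j) * z) \<le> 2 * cmod (kern j \<zeta>)" .
  qed (simp_all add: in_disc radial_in_cball[OF \<zeta>] summable_mult summable_kern \<zeta>)
  have "continuous_on ?X (\<lambda>z. if j \<in> S then blaschke_factor (a j) z else 1)" for j
    by (cases "j \<in> S") (simp_all add: holomorphic_on_imp_continuous_on holomorphic_blaschke_factor[OF in_disc radial_in_cball[OF \<zeta>]])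
  then show "continuous_on ?X (\<lambda>z. \<Prod>j<n. if j \<in> S then blaschke_factor (a j) z else 1)" for n
    by (intro continuous_on_prod)
qed simp

lemma continuous_on_radial_suminf:
  assumes \<zeta>: "cmod \<zeta> = 1" and L: "0 \<le> L"
    and h: "\<And>j. continuous_on ((\<lambda>r. of_real r * \<zeta>) ` {0..1}) (h j)"
    and le: "\<And>j z. cmod z \<le> 1 \<Longrightarrow> cmod (h j z) \<le> L * cmod (kern j z)"
  shows "continuous_on ((\<lambda>r. of_real r * \<zeta>) ` {0..1}) (\<lambda>z. \<Sum>j. h j z)"
proof (rule uniform_limit_theorem[OF always_eventually, rule_format])
  let ?X = "(\<lambda>r. of_real r * \<zeta>) ` {0..1}"
  show "uniform_limit ?X (\<lambda>n z. \<Sum>j<n. h j z) (\<lambda>z. \<Sum>j. h j z) sequentially"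
  proof (rule Weierstrass_m_test)
    show "cmod (h j z) \<le> L * (2 * cmod (kern j \<zeta>))" if z: "z \<in> ?X" for j z
      using le[of z j] subsetD[OF radial_in_cball[OF \<zeta>] z] mult_left_mono[OF norm_kern_radial[OF \<zeta> z, of j] L] by simp
    show "summable (\<lambda>j. L * (2 * cmod (kern j \<zeta>)))"
      by (intro summable_mult summable_kern) (simp add: \<zeta>)
  qed
  show "continuous_on ?X (\<lambda>z. \<Sum>j<n. h j z)" for n by (intro continuous_on_sum h)
qed simp

text \<open>The Blaschke condition gives locally uniform convergence, hence holomorphy; the Frostman
  bound gives the global bound \<open>L * M\<close>.\<close>

lemma suminf_in_H_inf:
  assumes L: "0 \<le> L" and h: "\<And>j. h j holomorphic_on unit_disc"
    and le: "\<And>j z. cmod z \<le> 1 \<Longrightarrow> cmod (h j z) \<le> L * cmod (kern j z)"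
  shows "(\<lambda>z. \<Sum>j. h j z) \<in> H_inf"
proof -
  have "(\<lambda>z. \<Sum>j. h j z) holomorphic_on unit_disc"
  proof (rule holomorphic_uniform_sequence[where f = "\<lambda>n z. \<Sum>j<n. h j z"])
    fix z assume "z \<in> unit_disc"
    define d where "d = (1 - cmod z) / 2"
    have d: "0 < d" "cmod z + d < 1" using \<open>z \<in> unit_disc\<close> by (auto simp: d_def field_simps)
    have xle: "cmod x \<le> cmod z + d" if "x \<in> cball z d" for x
      using that norm_triangle_ineq2[of x z] by (auto simp: dist_norm norm_minus_commute)
    have "uniform_limit (cball z d) (\<lambda>n z. \<Sum>j<n. h j z) (\<lambda>z. \<Sum>j. h j z) sequentially"
    proof (rule Weierstrass_m_test)
      show "cmod (h j x) \<le> L * (2 * ((1 - cmod (a j)) / (1 - (cmod z + d))))" if x: "x \<in> cball z d" for j x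
      proof -
        have "cmod (kern j x) \<le> 2 * (1 - cmod (a j)) / cmod (1 - cnj (a j) * x)"
          unfolding norm_kern by (intro divide_right_mono one_minus_le_sq) simp
        also have "\<dots> \<le> 2 * ((1 - cmod (a j)) / (1 - (cmod z + d)))"
          using mult_left_mono[OF term_bound[OF xle[OF x] d(2), of j], of 2] by (simp only: times_divide_eq_right)
        finally have "L * cmod (kern j x) \<le> L * (2 * ((1 - cmod (a j)) / (1 - (cmod z + d))))"
          by (intro mult_left_mono L)
        moreover have "cmod x \<le> 1" using xle[OF x] d(2) by simp
        ultimately show ?thesis using le[of x j] by linarith
      qed
      show "summable (\<lambda>j. L * (2 * ((1 - cmod (a j)) / (1 - (cmod z + d)))))"
        by (intro summable_mult summable_divide blaschke)
    qed
    moreover have "cball z d \<subseteq> unit_disc" using xle d(2) by force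
    ultimately show "\<exists>d>0. cball z d \<subseteq> unit_disc \<and>
        uniform_limit (cball z d) (\<lambda>n z. \<Sum>j<n. h j z) (\<lambda>z. \<Sum>j. h j z) sequentially"
      using d by blast
  qed (auto intro!: holomorphic_on_sum h)
  moreover have "cmod (\<Sum>j. h j z) \<le> L * M" if "z \<in> unit_disc" for z
  proof -
    have z: "cmod z \<le> 1" using that by simp
    have s: "summable (\<lambda>j. cmod (h j z))"
      by (rule summable_comparison_test'[OF summable_mult[OF summable_kern[OF z], of L], of 0]) (use le[OF z] in simp)
    have "cmod (\<Sum>j. h j z) \<le> (\<Sum>j. cmod (h j z))" by (rule summable_norm[OF s])
    also have "\<dots> \<le> (\<Sum>j. L * cmod (kern j z))"
      by (intro suminf_le s le z summable_mult summable_kern)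
    also have "\<dots> \<le> L * M"
      using suminf_mult[OF summable_kern[OF z], of L] mult_left_mono[OF suminf_kern[OF z] L] by simp
    finally show ?thesis .
  qed
  ultimately show ?thesis unfolding H_inf_def bounded_iff by blast
qed

text \<open>Separation together with the Frostman bound yields Carleson's uniform separation. Each
  factor is at least the exponential of minus a multiple of its kernel value at \<open>a k\<close>,
  and these values sum to at most \<open>M\<close>.\<close>

lemma norm_subproduct_ge:
  assumes \<epsilon>: "\<epsilon> > 0" "\<And>j. j \<noteq> k \<Longrightarrow> \<epsilon> \<le> pseudohyp (a j) (a k)"
  shows "exp (- M / \<epsilon>\<^sup>2) \<le> cmod (subproduct a (- {k}) (a k))"
proof (rule LIMSEQ_le_const)
  let ?F = "\<lambda>j. if j \<in> - {k} then blaschke_factor (a j) (a k) else 1"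
  have k1: "cmod (a k) \<le> 1" using in_disc[of k] by simp
  show "(\<lambda>n. cmod (\<Prod>j<n. ?F j)) \<longlonglongrightarrow> cmod (subproduct a (- {k}) (a k))"
    by (intro tendsto_norm subproduct_LIMSEQ regular_in_cball k1)
  have factor: "exp (- cmod (kern j (a k)) / \<epsilon>\<^sup>2) \<le> cmod (?F j)" for j
  proof (cases "j = k")
    case False
    define \<rho> where "\<rho> = pseudohyp (a j) (a k)"
    define t where "t = 1 - \<rho>\<^sup>2"
    have \<rho>: "\<epsilon> \<le> \<rho>" "0 < \<rho>" using \<epsilon>(1) \<epsilon>(2)[OF False] by (auto simp: \<rho>_def)
    have \<rho>1: "\<rho> \<le> 1" unfolding \<rho>_def by (rule pseudohyp_le_1[OF in_disc k1])
    have t0: "0 \<le> t" using \<rho> \<rho>1 by (simp add: t_def power_le_one)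
    define D where "D = cmod (1 - cnj (a j) * a k)"
    have D: "0 < D" using one_minus_cnj_mult_nz[OF in_disc k1] by (simp add: D_def)
    have "t = (1 - (cmod (a j))\<^sup>2) / D * ((1 - (cmod (a k))\<^sup>2) / D)"
      unfolding t_def \<rho>_def one_minus_pseudohyp_sq[OF in_disc k1] by (simp add: D_def power2_eq_square)
    also have "\<dots> \<le> cmod (kern j (a k)) * 2"
    proof -
      have "cmod (a j) * cmod (a k) \<le> cmod (a k)" using in_disc[of j] by (intro mult_left_le_one_le) auto
      then have "1 - cmod (a k) \<le> D" using norm_one_minus_ge[of "a j" "a k"] by (simp add: D_def)
      then have "(1 - (cmod (a k))\<^sup>2) / D \<le> 2" using one_minus_le_sq[of k] D by (simp add: pos_divide_le_eq)
      then show ?thesis unfolding norm_kern D_def[symmetric]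
        using one_minus_le_sq[of j] D by (intro mult_left_mono) auto
    qed
    finally have t: "t \<le> cmod (kern j (a k)) * 2" .
    \<comment> \<open>Separation enters by replacing \<open>\<rho>\<close> with
      \<open>\<epsilon>\<close> in the denominator; the later square root absorbs the factor 2 from
      \<open>t\<close>.\<close>
    have "1 / \<rho>\<^sup>2 = 1 + t / \<rho>\<^sup>2" using \<rho> by (simp add: t_def field_simps)
    also have "\<dots> \<le> exp (t / \<rho>\<^sup>2)" by (rule exp_ge_add_one_self)
    also have "t / \<rho>\<^sup>2 \<le> t / \<epsilon>\<^sup>2" using \<rho> \<epsilon>(1) t0 by (intro divide_left_mono power_mono mult_pos_pos) auto
    also have "t / \<epsilon>\<^sup>2 \<le> cmod (kern j (a k)) * 2 / \<epsilon>\<^sup>2" by (intro divide_right_mono t) simp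
    finally have "1 / \<rho>\<^sup>2 \<le> exp (cmod (kern j (a k)) * 2 / \<epsilon>\<^sup>2)" by simp
    also have "\<dots> = (exp (cmod (kern j (a k)) / \<epsilon>\<^sup>2))\<^sup>2" by (simp flip: exp_double)
    finally have "(1 / \<rho>)\<^sup>2 \<le> (exp (cmod (kern j (a k)) / \<epsilon>\<^sup>2))\<^sup>2" by (simp add: power_divide)
    then have "1 / \<rho> \<le> exp (cmod (kern j (a k)) / \<epsilon>\<^sup>2)" by (rule power2_le_imp_le) simp
    then have "exp (- (cmod (kern j (a k)) / \<epsilon>\<^sup>2)) \<le> \<rho>"
      using \<rho> by (simp add: exp_minus field_simps)
    then show ?thesis using False by (simp add: \<rho>_def norm_blaschke_factor)
  qed simp
  have "exp (- M / \<epsilon>\<^sup>2) \<le> cmod (\<Prod>j<n. ?F j)" for n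
  proof -
    have "exp (- M / \<epsilon>\<^sup>2) \<le> exp (- (\<Sum>j<n. cmod (kern j (a k))) / \<epsilon>\<^sup>2)"
      using kern_partial_sum[OF k1, of n] by (simp add: divide_right_mono)
    also have "\<dots> = (\<Prod>j<n. exp (- cmod (kern j (a k)) / \<epsilon>\<^sup>2))"
      by (simp add: exp_sum[symmetric] sum_negf[symmetric] sum_divide_distrib)
    also have "\<dots> \<le> (\<Prod>j<n. cmod (?F j))" by (intro prod_mono conjI factor) auto
    also have "\<dots> = cmod (\<Prod>j<n. ?F j)" by (rule prod_norm)
    finally show ?thesis .
  qed
  then show "\<exists>N. \<forall>n\<ge>N. exp (- M / \<epsilon>\<^sup>2) \<le> cmod (\<Prod>j<n. ?F j)" by blast
qed

text \<open>Since \<open>\<zeta> * cnj \<zeta>\<close> is 1, the numerator of the Blaschke factor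
  cancels the conjugated kernel denominator. The kernel thus has an explicit companion for its
  single factor; multiplying by the other factors gives one for the full product.\<close>

lemma kern_reflect:
  assumes "cmod \<zeta> = 1"
  shows "kern j \<zeta> = blaschke_factor (a j) \<zeta> * cnj (\<zeta> * (phase (a j) * kern j \<zeta>))"
proof -
  have z: "\<zeta> * cnj \<zeta> = 1" using assms by (simp add: complex_norm_square[symmetric])
  have p: "phase (a j) * cnj (phase (a j)) = 1" by (simp add: complex_norm_square[symmetric])
  have nz: "1 - cnj (a j) * \<zeta> \<noteq> 0" using one_minus_cnj_mult_nz[OF in_disc] assms by simp
  then have nz': "1 - a j * cnj \<zeta> \<noteq> 0"
    by (metis complex_cnj_cnj complex_cnj_diff complex_cnj_mult complex_cnj_one complex_cnj_zero)
  define s where "s = complex_of_real (1 - (cmod (a j))\<^sup>2)"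
  have s: "cnj s = s" by (simp add: s_def)
  have "blaschke_factor (a j) \<zeta> * cnj (\<zeta> * (phase (a j) * kern j \<zeta>))
      = (phase (a j) * cnj (phase (a j))) * ((\<zeta> - a j) * cnj \<zeta>) * s / ((1 - cnj (a j) * \<zeta>) * (1 - a j * cnj \<zeta>))"
    unfolding kern_def s_def[symmetric] by (simp add: blaschke_factor_phase s mult_ac)
  also have "(\<zeta> - a j) * cnj \<zeta> = 1 - a j * cnj \<zeta>" using z by (simp add: algebra_simps)
  also have "phase (a j) * cnj (phase (a j)) * (1 - a j * cnj \<zeta>) * s / ((1 - cnj (a j) * \<zeta>) * (1 - a j * cnj \<zeta>)) = kern j \<zeta>"
    unfolding kern_def s_def[symmetric] p using nz' by simp
  finally show ?thesis ..
qed

lemma separated_imp_interpolating: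
  assumes b: "cmod b = 1" and \<epsilon>: "\<epsilon> > 0" "\<And>j k. j \<noteq> k \<Longrightarrow> \<epsilon> \<le> pseudohyp (a j) (a k)"
  shows "interpolating a (K_inf (blaschke_product b a))"
  unfolding interpolating_def
proof (intro allI impI)
  fix \<alpha> :: "nat \<Rightarrow> complex" assume "bounded (range \<alpha>)"
  then obtain A where A: "\<And>j. cmod (\<alpha> j) \<le> A" by (auto simp: bounded_iff)
  define \<delta> where "\<delta> = exp (- M / \<epsilon>\<^sup>2)"
  have \<delta>: "0 < \<delta>" "\<And>k. \<delta> \<le> cmod (subproduct a (- {k}) (a k))"
    using norm_subproduct_ge[OF \<epsilon>] by (auto simp: \<delta>_def)
  define L where "L = A / \<delta>"
  have A0: "0 \<le> A" using order_trans[OF norm_ge_zero A] .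
  have L0: "0 \<le> L" using A0 \<delta> by (simp add: L_def)
  \<comment> \<open>The division normalises the j-th term to take the value
    \<open>\<alpha> j\<close> at \<open>a j\<close>; \<open>\<delta>\<close> keeps these
    coefficients bounded by \<open>L\<close>.\<close>
  define \<gamma> where "\<gamma> j = \<alpha> j / subproduct a (- {j}) (a j)" for j
  have \<gamma>: "cmod (\<gamma> j) \<le> L" for j
    unfolding \<gamma>_def norm_divide L_def using A A0 \<delta> by (intro frac_le) auto
  define h1 where "h1 j z = \<gamma> j * kern j z * subproduct a (- {j}) z" for j z
  define h2 where "h2 j z = cnj (\<gamma> j) * (phase (a j) * kern j z)" for j z
  define f where "f z = (\<Sum>j. h1 j z)" for z
  \<comment> \<open>The companion of \<open>f\<close>; the factor \<open>b\<close> compensates the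
    constant of the Blaschke product through \<open>b * cnj b = 1\<close>.\<close>
  define g where "g z = b * (\<Sum>j. h2 j z)" for z
  have h2_le: "cmod (h2 j z) \<le> L * cmod (kern j z)" for j z
    unfolding h2_def using \<gamma>[of j] by (simp add: norm_mult mult_right_mono)
  have h1_le: "cmod (h1 j z) \<le> L * cmod (kern j z)" if "cmod z \<le> 1" for j z
  proof -
    have "cmod (h1 j z) \<le> (L * cmod (kern j z)) * 1"
      unfolding h1_def norm_mult using \<gamma> L0 norm_subproduct_le_1[OF regular_in_cball[OF that]]
      by (intro mult_mono) auto
    then show ?thesis by simp
  qed
  have kern_D: "kern j holomorphic_on unit_disc" for j
    by (rule holomorphic_on_subset[OF holomorphic_kern]) auto
  have fH: "f \<in> H_inf"
    unfolding f_def[abs_def] using h1_le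
    by (intro suminf_in_H_inf[OF L0]) (auto simp: h1_def[abs_def] intro!: holomorphic_intros kern_D holomorphic_subproduct)
  have "(\<lambda>z. \<Sum>j. h2 j z) \<in> H_inf"
    using h2_le by (intro suminf_in_H_inf[OF L0]) (auto simp: h2_def[abs_def] intro!: holomorphic_intros kern_D)
  then have gH: "g \<in> H_inf"
    unfolding g_def[abs_def] H_inf_def using b by (auto simp: bounded_iff norm_mult intro!: holomorphic_intros)
  have boundary: "\<exists>u v y. has_boundary_value f \<zeta> u \<and> has_boundary_value (blaschke_product b a) \<zeta> v \<and>
      has_boundary_value g \<zeta> y \<and> u = v * cnj (\<zeta> * y)" if \<zeta>: "cmod \<zeta> = 1" for \<zeta>
  proof -
    let ?X = "(\<lambda>r. of_real r * \<zeta>) ` {0..1}"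
    have kc: "continuous_on ?X (kern j)" for j
      by (rule continuous_on_subset[OF holomorphic_on_imp_continuous_on[OF holomorphic_kern] radial_in_cball[OF \<zeta>]])
    have "continuous_on ?X f"
      unfolding f_def[abs_def] using h1_le
      by (intro continuous_on_radial_suminf[OF \<zeta> L0])
        (auto simp: h1_def[abs_def] intro!: continuous_intros kc continuous_on_radial_subproduct \<zeta>)
    moreover have "continuous_on ?X (\<lambda>z. \<Sum>j. h2 j z)"
      using h2_le by (intro continuous_on_radial_suminf[OF \<zeta> L0]) (auto simp: h2_def[abs_def] intro!: continuous_intros kc)
    then have "continuous_on ?X g" unfolding g_def[abs_def] by (intro continuous_intros)
    moreover have "continuous_on ?X (blaschke_product b a)"
      unfolding blaschke_product_subproduct[abs_def]
      by (intro continuous_intros continuous_on_radial_subproduct \<zeta>)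
    moreover have "f \<zeta> = blaschke_product b a \<zeta> * cnj (\<zeta> * g \<zeta>)"
    proof -
      have z1: "cmod \<zeta> \<le> 1" using \<zeta> by simp
      have bb: "b * cnj b = 1" using b by (simp add: complex_norm_square[symmetric])
      have s2: "summable (\<lambda>j. h2 j \<zeta>)"
        by (rule summable_norm_cancel, rule summable_comparison_test'[OF summable_mult[OF summable_kern[OF z1], of L], of 0])
          (use h2_le in simp)
      have "h1 j \<zeta> = subproduct a UNIV \<zeta> * cnj \<zeta> * cnj (h2 j \<zeta>)" for j
      proof -
        have "subproduct a ({j} \<union> (- {j})) \<zeta> = blaschke_factor (a j) \<zeta> * subproduct a (- {j}) \<zeta>"
          by (subst subproduct_split[OF regular_in_cball[OF z1]]) (auto simp: subproduct_finite)
        moreover have "h1 j \<zeta> = \<gamma> j * (blaschke_factor (a j) \<zeta> * cnj (\<zeta> * (phase (a j) * kern j \<zeta>))) * subproduct a (- {j}) \<zeta>"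
          unfolding h1_def kern_reflect[OF \<zeta>, symmetric] ..
        ultimately show ?thesis by (simp add: h2_def mult_ac)
      qed
      then have "f \<zeta> = (\<Sum>j. subproduct a UNIV \<zeta> * cnj \<zeta> * cnj (h2 j \<zeta>))" by (simp add: f_def)
      also have "\<dots> = subproduct a UNIV \<zeta> * cnj \<zeta> * (\<Sum>j. cnj (h2 j \<zeta>))"
        using s2 by (intro suminf_mult) (simp add: bounded_linear.summable[OF bounded_linear_cnj])
      also have "(\<Sum>j. cnj (h2 j \<zeta>)) = cnj (\<Sum>j. h2 j \<zeta>)"
        by (rule bounded_linear.suminf[OF bounded_linear_cnj s2, symmetric])
      also have "subproduct a UNIV \<zeta> * cnj \<zeta> * \<dots> = (b * cnj b) * (subproduct a UNIV \<zeta> * cnj \<zeta> * cnj (\<Sum>j. h2 j \<zeta>))"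
        using bb by simp
      also have "\<dots> = blaschke_product b a \<zeta> * cnj (\<zeta> * g \<zeta>)"
        by (simp add: blaschke_product_subproduct g_def mult_ac)
      finally show ?thesis .
    qed
    ultimately show ?thesis by (blast intro: has_boundary_value_continuous)
  qed
  have fK: "f \<in> K_inf (blaschke_product b a)"
    unfolding K_inf_def using fH gH boundary by (auto intro!: bexI[of _ g] AE_I2)
  have "f (a k) = \<alpha> k" for k
  proof -
    \<comment> \<open>For \<open>j\<close> other than \<open>k\<close> the product omitting
      \<open>j\<close> still contains the zero \<open>a k\<close>, so one term of the series
      survives.\<close>
    have "h1 j (a k) = 0" if "j \<noteq> k" for j
      using subproduct_zero[OF regular_in_disc[OF in_disc], of k "- {j}"] that by (simp add: h1_def)
    then have "f (a k) = h1 k (a k)"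
      unfolding f_def by (subst suminf_finite[of "{k}"]) auto
    also have "kern k (a k) = 1"
    proof -
      have "1 - cnj (a k) * a k = of_real (1 - (cmod (a k))\<^sup>2)"
        by (simp only: of_real_diff of_real_1 complex_norm_square mult.commute)
      then show ?thesis
        using one_minus_cnj_mult_nz[OF in_disc less_imp_le[OF in_disc], of k k] by (simp add: kern_def)
    qed
    then have "h1 k (a k) = \<alpha> k" using \<delta>(1) \<delta>(2)[of k] by (auto simp: h1_def \<gamma>_def)
    finally show ?thesis .
  qed
  then show "\<exists>f\<in>K_inf (blaschke_product b a). \<forall>n. f (a n) = \<alpha> n" using fK by blast
qed

end

section \<open>Equivalence with the Frostman condition and transfer between the sequences\<close>

lemma rho_separatedD:
  assumes "rho_separated a"
  obtains \<epsilon> where "\<epsilon> > 0" "\<And>j k. j \<noteq> k \<Longrightarrow> \<epsilon> \<le> pseudohyp (a j) (a k)"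
proof
  let ?I = "INF (j, k)\<in>{(j, k). j \<noteq> k}. pseudohyp (a j) (a k)"
  show "?I > 0" using assms by (simp add: rho_separated_def)
  show "?I \<le> pseudohyp (a j) (a k)" if "j \<noteq> k" for j k
  proof -
    have "bdd_below ((\<lambda>(j, k). pseudohyp (a j) (a k)) ` {(j, k). j \<noteq> k})"
      by (rule bdd_belowI2[of _ 0]) auto
    from cINF_lower[OF this, of "(j, k)"] that show ?thesis by simp
  qed
qed

lemma interpolating_iff_frostman:
  assumes "\<And>n. cmod (a n) < 1" "blaschke_condition a" "rho_separated a" "cmod b = 1"
  shows "interpolating a (K_inf (blaschke_product b a)) \<longleftrightarrow> frostman a"
proof
  interpret blaschke_sequence a
    using assms by unfold_locales (auto simp: blaschke_condition_def)
  obtain \<epsilon> where \<epsilon>: "\<epsilon> > 0" "\<And>j k. j \<noteq> k \<Longrightarrow> \<epsilon> \<le> pseudohyp (a j) (a k)"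
    using rho_separatedD[OF assms(3)] by blast
  have "inj a"
  proof (rule injI, rule ccontr)
    fix j k assume "a j = a k" "j \<noteq> k"
    then show False using \<epsilon>(2)[of j k] \<epsilon>(1) by (simp add: pseudohyp_def)
  qed
  then show "interpolating a (K_inf (blaschke_product b a)) \<Longrightarrow> frostman a"
    by (rule interpolating_imp_frostman[OF _ assms(4)])
  assume "frostman a"
  then obtain M where M: "\<And>w N. cmod w < 1 \<Longrightarrow> (\<Sum>j<N. (1 - (cmod (a j))\<^sup>2) / cmod (1 - cnj w * a j)) \<le> M"
    unfolding frostman_def by blast
  interpret frostman_sequence a M using M by unfold_locales
  show "interpolating a (K_inf (blaschke_product b a))"
    by (rule separated_imp_interpolating[OF assms(4) \<epsilon>])
qed

theorem corollary5p3:
  fixes a z :: "nat \<Rightarrow> complex" and \<mu> :: real and b c :: complex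
    and B C :: "complex \<Rightarrow> complex"
  assumes "\<And>n. a n \<in> unit_disc" and "\<And>n. z n \<in> unit_disc"
    and "blaschke_condition a" and "blaschke_condition z"
    and "rho_separated a" and "rho_separated z"
    and "(SUP n. pseudohyp (a n) (z n)) \<le> \<mu>" and "\<mu> < 1"
    and "cmod b = 1" and "cmod c = 1"
    and "B = blaschke_product b a" and "C = blaschke_product c z"
  shows "interpolating a (K_inf B) \<longleftrightarrow> interpolating z (K_inf C)"
proof -
  have a: "cmod (a n) < 1" and z: "cmod (z n) < 1" for n using assms(1,2)[of n] by auto
  \<comment> \<open>A real supremum dominates its terms only for a family bounded above; here 1 is a
    bound.\<close>
  have "bdd_above (range (\<lambda>n. pseudohyp (a n) (z n)))"
    by (rule bdd_aboveI2[of _ _ 1]) (simp add: a z less_imp_le pseudohyp_le_1)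
  then have le: "pseudohyp (a n) (z n) \<le> \<mu>" for n
    using cSUP_upper[of n UNIV "\<lambda>n. pseudohyp (a n) (z n)"] assms(7) by (meson UNIV_I order_trans)
  \<comment> \<open>The pseudohyperbolic distance is symmetric, so the perturbation lemma applies in
    both directions.\<close>
  have "frostman a \<longleftrightarrow> frostman z"
    using frostman_perturb[of a z, OF a z le assms(8)] frostman_perturb[of z a \<mu>, OF z a _ assms(8)] le
    by (auto simp: pseudohyp_sym[of "z _"])
  then show ?thesis
    unfolding assms(11,12) using assms a z by (simp add: interpolating_iff_frostman)
qed

end
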